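(* Let $\Gamma_0$ be the two-generator Schottky group acting on the Poincaré disc $B^2$ described in the context. There are uncountably many limit points of $\Gamma_0$ which are concentration points for $\Gamma_0$ but are not controlled concentration points for $\Gamma_0$.
   Context: The group $\Gamma_0$: work in the Poincaré unit disc $B^2\subset\mathbf{C}$ with circle at infinity $S^1=\partial B^2$. Let $a,a'$ be two geodesics of $B^2$ which are arcs of Euclidean circles with centers on the real axis, one on each side of the origin, and let $b,b'$ be two geodesics which are arcs of Euclidean circles with centers on the imaginary axis, one on each side of the origin, such that the closures of the four geodesics in $B^2\cup S^1$ are pairwise disjoint, and the region of $B^2$ containing the origin and bounded by these four geodesics has all four of them as its frontier. $\Gamma_0$ is the group generated by two (orientation-preserving, hyperbolic) isometries of $B^2$, one of which preserves the real axis and carries $a'$ to $a$, and the other of which preserves the imaginary axis and carries $b'$ to $b$; the region bounded by $a,a',b,b'$ is a fundamental domain for the action of $\Gamma_0$ on $B^2$. The limit set of $\Gamma_0$ is a Cantor set in $S^1$. Definitions, for a discrete group $\Gamma$ of Möbius transformations of $B^2$ acting on $S^1$ (neighborhoods are open subsets of $S^1$): An open set $U\subseteq S^1$ can be concentrated at $p\in S^1$ if for every neighborhood $V$ of $p$ there exists $\gamma\in\Gamma$ such that $p\in\gamma(U)$ and $\gamma(U)\subseteq V$. If in addition the element $\gamma$ can always be selected so that $p\in\gamma(V)$, then $U$ can be concentrated with control at $p$. A limit point $p$ is a controlled concentration point for $\Gamma$ if it has a neighborhood which can be concentrated with control at $p$. A limit point $p$ is a concentration point for $\Gamma$ if every sufficiently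 small connected neighborhood of $p$ can be concentrated at $p$ (i.e. there is a neighborhood $W$ of $p$ such that every connected neighborhood $U\subseteq W$ of $p$ can be concentrated at $p$). *)

theory Defs
  imports "HOL-Complex_Analysis.Riemann_Mapping" "HOL-Algebra.Bij"
    "HOL-Algebra.Generated_Groups"
begin

(* A Moebius transformation preserving B^2 is represented by its action on the closed disc, extended
   by "undefined" outside, as the carrier of the library's BijGroup requires; this also avoids
   the pole of Moebius_function, which lies outside the closed disc. *)
definition disc_isometries :: "(complex \<Rightarrow> complex) set" where
  "disc_isometries =
     {restrict (Moebius_function t w) (cball 0 1) | t w. norm w < 1}"

definition hyperbolic :: "(complex \<Rightarrow> complex) \<Rightarrow> bool" where
  "hyperbolic \<gamma> \<longleftrightarrow> \<gamma> \<in> disc_isometries \<and> card {p \<in> sphere 0 1. \<gamma> p = p} = 2"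

definition generated_group :: "(complex \<Rightarrow> complex) set \<Rightarrow> (complex \<Rightarrow> complex) set" where
  "generated_group S = generate (BijGroup (cball 0 1)) S"

(* By Pythagoras, the circle with centre c and radius r meets the unit circle orthogonally
   iff |c|^2 = 1 + r^2. *)
definition circle_geodesic :: "complex \<Rightarrow> complex set \<Rightarrow> bool" where
  "circle_geodesic c A \<longleftrightarrow>
     (\<exists>r>0. (norm c)\<^sup>2 = 1 + r\<^sup>2 \<and> A = ball 0 1 \<inter> sphere c r)"

definition real_axis :: "complex set" where
  "real_axis = {z \<in> ball 0 1. Im z = 0}"

definition imaginary_axis :: "complex set" where
  "imaginary_axis = {z \<in> ball 0 1. Re z = 0}"

definition schottky_geodesics ::
  "complex set \<Rightarrow> complex set \<Rightarrow> complex set \<Rightarrow> complex set \<Rightarrow> bool" where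
  "schottky_geodesics a a' b b' \<longleftrightarrow>
     (\<exists>s s'. s * s' < 0 \<and> circle_geodesic (complex_of_real s) a
                       \<and> circle_geodesic (complex_of_real s') a') \<and>
     (\<exists>t t'. t * t' < 0 \<and> circle_geodesic (\<i> * complex_of_real t) b
                       \<and> circle_geodesic (\<i> * complex_of_real t') b') \<and>
     disjnt (closure a) (closure a') \<and> disjnt (closure a) (closure b) \<and>
     disjnt (closure a) (closure b') \<and> disjnt (closure a') (closure b) \<and>
     disjnt (closure a') (closure b') \<and> disjnt (closure b) (closure b') \<and>
     ball 0 1 \<inter> frontier (connected_component_set (ball 0 1 - (a \<union> a' \<union> b \<union> b')) 0)
       = a \<union> a' \<union> b \<union> b'"

definition limit_point :: "(complex \<Rightarrow> complex) set \<Rightarrow> complex \<Rightarrow> bool" where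
  "limit_point \<Gamma> p \<longleftrightarrow>
     p \<in> sphere 0 1 \<and> (\<exists>x \<in> ball 0 1. p islimpt ((\<lambda>\<gamma>. \<gamma> x) ` \<Gamma>))"

definition circle_nbhd :: "complex \<Rightarrow> complex set \<Rightarrow> bool" where
  "circle_nbhd p V \<longleftrightarrow> openin (top_of_set (sphere 0 1)) V \<and> p \<in> V"

definition can_be_concentrated ::
  "(complex \<Rightarrow> complex) set \<Rightarrow> complex set \<Rightarrow> complex \<Rightarrow> bool" where
  "can_be_concentrated \<Gamma> U p \<longleftrightarrow>
     (\<forall>V. circle_nbhd p V \<longrightarrow> (\<exists>\<gamma>\<in>\<Gamma>. p \<in> \<gamma> ` U \<and> \<gamma> ` U \<subseteq> V))"

definition can_be_concentrated_with_control ::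
  "(complex \<Rightarrow> complex) set \<Rightarrow> complex set \<Rightarrow> complex \<Rightarrow> bool" where
  "can_be_concentrated_with_control \<Gamma> U p \<longleftrightarrow>
     (\<forall>V. circle_nbhd p V \<longrightarrow> (\<exists>\<gamma>\<in>\<Gamma>. p \<in> \<gamma> ` U \<and> \<gamma> ` U \<subseteq> V \<and> p \<in> \<gamma> ` V))"

definition controlled_concentration_point ::
  "(complex \<Rightarrow> complex) set \<Rightarrow> complex \<Rightarrow> bool" where
  "controlled_concentration_point \<Gamma> p \<longleftrightarrow>
     limit_point \<Gamma> p \<and> (\<exists>U. circle_nbhd p U \<and> can_be_concentrated_with_control \<Gamma> U p)"

definition concentration_point :: "(complex \<Rightarrow> complex) set \<Rightarrow> complex \<Rightarrow> bool" where
  "concentration_point \<Gamma> p \<longleftrightarrow>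
     limit_point \<Gamma> p \<and>
     (\<exists>W. circle_nbhd p W \<and>
       (\<forall>U. circle_nbhd p U \<and> connected U \<and> U \<subseteq> W \<longrightarrow> can_be_concentrated \<Gamma> U p))"

end

theory Submission
  imports Defs
begin

text \<open>
  Let \<open>g\<close> and \<open>h\<close> be the two translations. Each letter \<open>g\<close>, \<open>g\<inverse>\<close>, \<open>h\<close>, \<open>h\<inverse>\<close> attracts onto one of the
  four half-discs cut off by the geodesics, and repels from the half-disc of the inverse letter. By
  ping-pong, every infinite reduced word \<open>p\<close> in these letters codes a point \<open>z\<close> of the circle: the
  cylinders of \<open>p\<close>, which are the arcs obtained by applying the first \<open>n\<close> letters to the arc of the
  next one, shrink to \<open>z\<close>. Distinct words code distinct points, and every coded point is a limit
  point. Both concentration properties can then be read off from recurrence in \<open>p\<close>.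

  \<^item> \<^emph>\<open>Control forces recurrence.\<close> Suppose that a neighbourhood \<open>U\<close> is concentrated with control at \<open>z\<close>, take
  for \<open>V\<close> the interior of the \<open>n\<close>-th cylinder and let \<open>\<gamma>\<close> be the group element obtained. Because \<open>\<gamma>\<inverse> z\<close> lies in \<open>V\<close>,
  it starts with the first \<open>n\<close> letters of \<open>p\<close>; because \<open>\<gamma> U\<close> is contained in \<open>V\<close>, only a bounded
  number of these letters can cancel against \<open>\<gamma>\<close>. So the word formed by the remaining ones occurs
  again further on in \<open>p\<close> (lemma \<open>not_concentrated_with_control\<close>).

  \<^item> \<^emph>\<open>Concentration needs less.\<close> Let \<open>U\<close> be a small arc around \<open>z\<close>. Undo the first \<open>n\<close> letters of \<open>p\<close>,
  where \<open>n\<close> is least such that \<open>U\<close> contains the \<open>n\<close>-th cylinder. The resulting arc \<open>U'\<close> is large: it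
  contains the arc of the next letter \<open>x\<close>. But it misses the arc of a whole reduced word, and it also
  misses a point outside the arc of the first letter of that word. If a connected set misses a point
  in the arc of a letter and one in the arc of its inverse, it misses one of the two complementary
  arcs completely. Hence \<open>U'\<close> misses the arc of an \<^emph>\<open>alternating\<close> word \<open>v\<close>, in which letters of the two
  generators take turns (lemma \<open>avoid_alternating_region\<close>). If \<open>v\<inverse> x\<close> occurs far out in \<open>p\<close>, the
  letters of \<open>p\<close> up to the end of \<open>v\<inverse>\<close> carry \<open>U'\<close> to a tiny arc around \<open>z\<close> (lemma \<open>concentrate\<close>).

  It remains to find uncountably many words \<open>p\<close> that contain every alternating word followed by any
  admissible letter infinitely often, while arbitrarily late windows of \<open>p\<close> never recur. Such words
  are obtained by listing finite words without three consecutive letters \<open>g\<close>, each infinitely often, and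
  separating them by runs of \<open>g\<close> whose lengths increase: the runs never repeat. A free binary
  choice in each block gives uncountably many of them.

  The hypotheses enter through plane geometry: the generators turn out to be hyperbolic translations
  along the two axes, and the disjointness of the closures of the geodesics becomes the inequality
  \<open>1 / s\<^sup>2 + 1 / t\<^sup>2 > 1\<close> for centres \<open>s\<close> and \<open>\<i> t\<close>.
\<close>

section \<open>Words in two generators\<close>

text \<open>The first component selects the generator (\<open>False\<close> for \<open>g\<close>, which translates along the real axis,
  and \<open>True\<close> for \<open>h\<close>); the second one is \<open>True\<close> for the generator and \<open>False\<close> for its inverse.\<close>
type_synonym letter = "bool \<times> bool"

definition linv :: "letter \<Rightarrow> letter" where
  "linv x = (fst x, \<not> snd x)"

lemma linv_linv [simp]: "linv (linv x) = x"
  by (simp add: linv_def)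

lemma linv_neq [simp]: "linv x \<noteq> x" "x \<noteq> linv x"
  by (auto simp: linv_def prod_eq_iff)

lemma fst_linv [simp]: "fst (linv x) = fst x"
  by (simp add: linv_def)

lemma fst_eq_cases: "fst x = fst y \<Longrightarrow> x = y \<or> x = linv y"
  by (auto simp: linv_def prod_eq_iff)

definition winv :: "letter list \<Rightarrow> letter list" where
  "winv w = map linv (rev w)"

lemma winv_simps [simp]:
  "winv [] = []" "winv (x # w) = winv w @ [linv x]" "winv (v @ w) = winv w @ winv v"
  "winv (winv w) = w" "winv w = [] \<longleftrightarrow> w = []" "length (winv w) = length w"
  by (auto simp: winv_def rev_map comp_def)

lemma hd_winv: "w \<noteq> [] \<Longrightarrow> hd (winv w) = linv (last w)"
  by (simp add: winv_def hd_map hd_rev)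

lemma last_winv: "w \<noteq> [] \<Longrightarrow> last (winv w) = linv (hd w)"
  by (simp add: winv_def last_map last_rev)

abbreviation reduced :: "letter list \<Rightarrow> bool" where
  "reduced \<equiv> successively (\<lambda>x y. y \<noteq> linv x)"

abbreviation alternating :: "letter list \<Rightarrow> bool" where
  "alternating \<equiv> successively (\<lambda>x y. fst x \<noteq> fst y)"

lemma reduced_winv [simp]: "reduced (winv w) \<longleftrightarrow> reduced w"
proof -
  have eq: "(\<lambda>x y. linv x \<noteq> linv (linv y)) = (\<lambda>x y. y \<noteq> linv x)"
    by (auto simp: fun_eq_iff)
  show ?thesis
    unfolding winv_def successively_map successively_rev eq ..
qed

lemma alternating_winv [simp]: "alternating (winv w) \<longleftrightarrow> alternating w"
  unfolding winv_def successively_map successively_rev by (simp add: eq_commute)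

lemma alternating_imp_reduced: "alternating w \<Longrightarrow> reduced w"
  by (erule successively_mono) auto

text \<open>Two consecutive letters of a reduced word that belong to the same generator are equal, so the first
  failure of alternation is a repeated letter.\<close>
lemma alternating_prefix_cases:
  assumes "reduced s" "s \<noteq> []"
  shows "alternating s \<or> (\<exists>t y r. s = t @ [y, y] @ r \<and> alternating (t @ [y]))"
  using assms
proof (induction s)
  case (Cons x s)
  show ?case
  proof (cases s)
    case (Cons y s')
    have red: "reduced s" "y \<noteq> linv x" using Cons.prems Cons by auto
    have IH: "alternating s \<or> (\<exists>t y r. s = t @ [y, y] @ r \<and> alternating (t @ [y]))"
      using Cons.IH red Cons by blast
    show ?thesis
    proof (cases "fst x = fst y")
      case True
      then have "x = y" using red fst_eq_cases by metis
      then show ?thesis using Cons by (intro disjI2 exI[of _ "[]"]) auto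
    next
      case False
      from IH show ?thesis
      proof (elim disjE exE conjE)
        assume "alternating s"
        then show ?thesis using False Cons by auto
      next
        fix t z r assume tz: "s = t @ [z, z] @ r" "alternating (t @ [z])"
        then have "alternating ((x # t) @ [z])"
          using False Cons by (cases t) auto
        then show ?thesis using tz by (intro disjI2 exI[of _ "x # t"]) auto
      qed
    qed
  qed auto
qed auto

section \<open>Recurrence in sequences of letters\<close>

definition occurs_at :: "letter list \<Rightarrow> (nat \<Rightarrow> letter) \<Rightarrow> nat \<Rightarrow> bool" where
  "occurs_at w p N \<longleftrightarrow> (\<forall>i<length w. p (N + i) = w ! i)"

definition reduced_seq :: "(nat \<Rightarrow> letter) \<Rightarrow> bool" where
  "reduced_seq p \<longleftrightarrow> (\<forall>n. p (Suc n) \<noteq> linv (p n))"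

abbreviation letter_g :: letter where "letter_g \<equiv> (False, True)"

text \<open>The words that are placed between long runs of \<open>g\<close>. They begin and end with a letter of \<open>h\<close>, so
  that each run of \<open>g\<close> keeps its exact length, and they contain no run that could be mistaken for one
  of the long ones.\<close>
definition filler :: "letter list \<Rightarrow> bool" where
  "filler w \<longleftrightarrow> w \<noteq> [] \<and> fst (hd w) \<and> fst (last w) \<and> reduced w \<and>
     (\<forall>i. i + 2 < length w \<longrightarrow> w ! i = letter_g \<longrightarrow> w ! (i + 1) = letter_g \<longrightarrow> w ! (i + 2) \<noteq> letter_g)"

fun concat_len :: "(nat \<Rightarrow> 'a list) \<Rightarrow> nat \<Rightarrow> nat" where
  "concat_len B 0 = 0"
| "concat_len B (Suc n) = concat_len B n + length (B n)"

text \<open>The first \<open>Suc i\<close> blocks suffice to reach position \<open>i\<close>, provided that all blocks are nonempty.\<close>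
definition concat_seq :: "(nat \<Rightarrow> 'a list) \<Rightarrow> nat \<Rightarrow> 'a" where
  "concat_seq B i = concat (map B [0..<Suc i]) ! i"

lemma length_concat_upt: "length (concat (map B [0..<n])) = concat_len B n"
  by (induction n) auto

lemma concat_upt_mono:
  assumes "m \<le> n" shows "\<exists>ys. concat (map B [0..<n]) = concat (map B [0..<m]) @ ys"
proof -
  have "[0..<n] = [0..<m] @ [m..<n]" using assms upt_add_eq_append[of 0 m "n-m"] by simp
  then show ?thesis by simp
qed

lemma concat_len_mono: "m \<le> n \<Longrightarrow> concat_len B m \<le> concat_len B n"
  by (rule lift_Suc_mono_le[of "concat_len B"]) auto

lemma concat_len_ge:
  assumes "\<And>n. B n \<noteq> []" shows "n \<le> concat_len B n"
proof (induction n)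
  case (Suc n)
  then show ?case using assms[of n] by (cases "B n") auto
qed auto

lemma concat_seq_block:
  assumes ne: "\<And>n. B n \<noteq> []" and i: "i < length (B n)"
  shows "concat_seq B (concat_len B n + i) = B n ! i"
proof -
  let ?N = "concat_len B n + i"
  have "n \<le> ?N" using concat_len_ge[of B n] ne by simp
  then obtain ys where "concat (map B [0..<Suc ?N]) = concat (map B [0..<Suc n]) @ ys"
    using concat_upt_mono[of "Suc n" "Suc ?N" B] by auto
  then show ?thesis
    using i length_concat_upt[of B n] unfolding concat_seq_def
    by (simp add: nth_append)
qed

lemma concat_len_index:
  assumes ne: "\<And>n. B n \<noteq> []"
  obtains n i where "N = concat_len B n + i" "i < length (B n)"
proof -
  define n where "n = (LEAST n. N < concat_len B (Suc n))"
  have "N < concat_len B (Suc N)" using concat_len_ge[of B "Suc N"] ne by simp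
  then have 1: "N < concat_len B (Suc n)" unfolding n_def by (rule LeastI)
  have 2: "concat_len B n \<le> N"
  proof (cases n)
    case (Suc m)
    then show ?thesis
      using not_less_Least[of m "\<lambda>n. N < concat_len B (Suc n)"] unfolding n_def
      by (metis lessI not_le)
  qed auto
  show thesis by (rule that[of n "N - concat_len B n"]) (use 1 2 in auto)
qed

text \<open>The offset 3 makes every separating run longer than all runs of \<open>g\<close> inside fillers.\<close>
definition blocks :: "(nat \<Rightarrow> letter list) \<Rightarrow> nat \<Rightarrow> letter list" where
  "blocks W n = replicate (n + 3) letter_g @ W n"

lemma filler_append:
  assumes "filler v" "filler w"
  shows "filler (v @ [letter_g] @ w)"
  unfolding filler_def
proof (intro conjI allI impI)
  show "reduced (v @ [letter_g] @ w)"
    using assms by (auto simp: filler_def successively_append_iff successively_Cons linv_def prod_eq_iff)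
  fix i assume i: "i + 2 < length (v @ [letter_g] @ w)" "(v @ [letter_g] @ w) ! i = letter_g"
    "(v @ [letter_g] @ w) ! (i + 1) = letter_g"
  have l: "fst (v ! (length v - 1))" "fst (w ! 0)" "v \<noteq> []" "w \<noteq> []"
    using assms by (auto simp: filler_def last_conv_nth hd_conv_nth)
  show "(v @ [letter_g] @ w) ! (i + 2) \<noteq> letter_g"
  proof (cases "i + 2 < length v")
    case True
    then show ?thesis using i assms(1) by (auto simp: filler_def nth_append)
  next
    case False
    consider "i + 2 = length v" | "i + 1 = length v" | "i = length v" | "i \<ge> length v + 1"
      using False by linarith
    then show ?thesis
    proof cases
      case 1
      then have "i + 1 = length v - 1" "i + 1 < length v" by auto
      then have "fst ((v @ [letter_g] @ w) ! (i + 1))" using l by (simp add: nth_append)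
      then show ?thesis using i by simp
    next
      case 2
      then have "i = length v - 1" "i < length v" by auto
      then have "fst ((v @ [letter_g] @ w) ! i)" using l by (simp add: nth_append)
      then show ?thesis using i by simp
    next
      case 3
      then have "fst ((v @ [letter_g] @ w) ! (i + 1))" using l by (simp add: nth_append)
      then show ?thesis using i by simp
    next
      case 4
      then obtain k where "i = length v + 1 + k" using le_Suc_ex by blast
      then show ?thesis using i assms(2) by (auto simp: filler_def nth_append)
    qed
  qed
qed (use assms in \<open>auto simp: filler_def\<close>)

context
  fixes W :: "nat \<Rightarrow> letter list"
  assumes W: "\<And>n. filler (W n)"
begin

abbreviation "block_pos \<equiv> concat_len (blocks W)"
abbreviation "block_seq \<equiv> concat_seq (blocks W)"

lemma blocks_ne [simp]: "blocks W n \<noteq> []"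
  by (simp add: blocks_def)

lemma length_blocks [simp]: "length (blocks W n) = n + 3 + length (W n)"
  by (simp add: blocks_def)

lemma W_pos: "length (W n) > 0" "W n \<noteq> []"
  using W[of n] by (auto simp: filler_def)

lemma block_seq_run: "i < n + 3 \<Longrightarrow> block_seq (block_pos n + i) = letter_g"
  by (subst concat_seq_block) (auto simp: blocks_def nth_append)

lemma block_seq_W: "i < length (W n) \<Longrightarrow> block_seq (block_pos n + (n + 3) + i) = W n ! i"
  using concat_seq_block[of "blocks W" "n + 3 + i" n]
  by (auto simp: blocks_def nth_append add.assoc)

lemma block_seq_first: "fst (block_seq (block_pos n + (n + 3)))"
  using block_seq_W[of 0 n] W[of n] W_pos[of n] by (auto simp: filler_def hd_conv_nth)

lemma block_seq_last: "fst (block_seq (block_pos (Suc n) - 1))"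
proof -
  have "block_pos (Suc n) - 1 = block_pos n + (n + 3) + (length (W n) - 1)" using W_pos[of n] by simp
  then show ?thesis
    using block_seq_W[of "length (W n) - 1" n] W[of n] W_pos[of n]
    by (auto simp: filler_def last_conv_nth)
qed

lemma reduced_seq_block_seq: "reduced_seq block_seq"
  unfolding reduced_seq_def
proof
  fix N
  obtain n i where N: "N = block_pos n + i" "i < length (blocks W n)"
    using concat_len_index[of "blocks W" N] by auto
  have red: "reduced (blocks W n)"
    using W[of n] W_pos[of n]
    by (auto simp: blocks_def successively_append_iff filler_def linv_def prod_eq_iff
        successively_conv_nth[of _ "replicate _ _"])
  show "block_seq (Suc N) \<noteq> linv (block_seq N)"
  proof (cases "Suc i < length (blocks W n)")
    case True
    then show ?thesis using concat_seq_block[of "blocks W" i n] concat_seq_block[of "blocks W" "Suc i" n] N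
      successively_nth[OF red True] by simp
  next
    case False
    then have eq: "Suc N = block_pos (Suc n)" using N by simp
    have "block_seq (block_pos (Suc n) + 0) = letter_g" by (rule block_seq_run) simp
    then have "block_seq (Suc N) = letter_g" by (simp only: eq add_0_right)
    moreover have "fst (block_seq N)" using block_seq_last[of n] eq by (metis diff_Suc_1)
    ultimately show ?thesis by (auto simp: linv_def)
  qed
qed

text \<open>Fillers contain no run of three letters \<open>g\<close>, so a run that starts later and has at least this
  length is the separating run of a later block, hence strictly longer than \<open>n + 3\<close>.\<close>
lemma block_seq_later_run:
  assumes q: "q \<ge> block_pos n + (n + 3)" and b: "fst (block_seq (q - 1))"
    and r: "\<And>i. i < 3 \<Longrightarrow> block_seq (q + i) = letter_g"
  shows "block_seq (q + (n + 3)) = letter_g"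
proof -
  obtain m i where mi: "q = block_pos m + i" "i < length (blocks W m)"
    using concat_len_index[of "blocks W" q] by auto
  have mn: "m \<ge> n"
  proof (rule ccontr)
    assume "\<not> m \<ge> n"
    then have "block_pos (Suc m) \<le> block_pos n" by (intro concat_len_mono) auto
    then show False using mi q by simp
  qed
  show ?thesis
  proof (cases "i < m + 3")
    case True
    have "i = 0"
    proof (rule ccontr)
      assume "i \<noteq> 0"
      then have "block_seq (block_pos m + (i - 1)) = letter_g" using True by (intro block_seq_run) auto
      then show False using b mi \<open>i \<noteq> 0\<close> by simp
    qed
    then have "m \<noteq> n" using q mi by auto
    then show ?thesis using \<open>i = 0\<close> mi mn by (simp add: block_seq_run)
  next
    case False
    define k where "k = i - (m + 3)"
    have q': "q = block_pos m + (m + 3) + k" and k: "k < length (W m)"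
      using False mi by (auto simp: k_def)
    have last: "fst (W m ! (length (W m) - 1))"
      using W[of m] by (auto simp: filler_def last_conv_nth)
    have k2: "k + 2 < length (W m)"
    proof (rule ccontr)
      assume *: "\<not> k + 2 < length (W m)"
      define j where "j = length (W m) - 1 - k"
      have "j < 3" "k + j = length (W m) - 1" using * k by (auto simp: j_def)
      then have "block_seq (q + j) = W m ! (length (W m) - 1)"
        using q' block_seq_W[of "k + j" m] k by (simp add: add.assoc)
      then show False using last r[OF \<open>j < 3\<close>] by (metis fst_conv)
    qed
    have "k + i < length (W m)" if "i < 3" for i using that k2 by simp
    then have "W m ! (k + i) = letter_g" if "i < 3" for i
      using r[OF that] block_seq_W[of "k + i" m] q' that by (simp add: add.assoc)
    from this[of 0] this[of 1] this[of 2] have False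
      using W[of m] k2 unfolding filler_def by auto
    then show ?thesis ..
  qed
qed

text \<open>The window is chosen to contain a complete separating run with the letters of \<open>h\<close> on both sides.
  A later copy would be a run of the same exact length, but later runs are longer.\<close>
lemma block_seq_nonrecurrent:
  "\<exists>n\<ge>k. \<forall>j>n. \<exists>i\<le>n - k. block_seq (j + i) \<noteq> block_seq (k + i)"
proof -
  define n where "n = Suc k"
  define e where "e = block_pos n + (n + 3)"
  have k: "k < block_pos n" using concat_len_ge[of "blocks W" n] by (auto simp: n_def)
  have "\<exists>i\<le>e - k. block_seq (j + i) \<noteq> block_seq (k + i)" if j: "j > e" for j
  proof (rule ccontr)
    assume "\<not> ?thesis"
    then have eq: "block_seq (j + i) = block_seq (k + i)" if "i \<le> e - k" for i using that by auto
    define q where "q = j + (block_pos n - k)"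
    have eq': "block_seq (q + i) = block_seq (block_pos n + i)" if "i \<le> n + 3" for i
      using eq[of "block_pos n - k + i"] that k by (auto simp: q_def e_def add.assoc)
    have "q - 1 = j + (block_pos n - 1 - k)" "k + (block_pos n - 1 - k) = block_pos n - 1" using k by (auto simp: q_def)
    then have "fst (block_seq (q - 1))"
      using eq[of "block_pos n - 1 - k"] block_seq_last[of k] by (simp del: concat_len.simps add: n_def e_def)
    moreover have "q \<ge> block_pos n + (n + 3)" using j by (simp add: q_def e_def)
    moreover have "block_seq (q + i) = letter_g" if "i < 3" for i
      using eq'[of i] block_seq_run[of i n] that by simp
    ultimately have "block_seq (q + (n + 3)) = letter_g" by (intro block_seq_later_run) auto
    then show False using eq'[of "n + 3"] block_seq_first[of n] by simp
  qed
  moreover have "e \<ge> k" using k by (simp add: e_def)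
  ultimately show ?thesis by blast
qed

end

lemma filler_singleton: "fst x \<Longrightarrow> filler [x]"
  by (simp add: filler_def)

text \<open>An alternating word followed by one letter has at most two equal consecutive letters, and only at
  its end; so at most one letter of \<open>h\<close> on either side turns it into a filler.\<close>
lemma filler_extension:
  assumes v: "alternating v" "v \<noteq> []" and x: "x \<noteq> linv (last v)"
  obtains a b where "filler (a @ (v @ [x]) @ b)"
proof -
  define a where "a = (if fst (hd v) then [] else [(True, True)])"
  define b where "b = (if fst x then [] else [(True, True)])"
  let ?w = "a @ (v @ [x]) @ b"
  have nth: "?w ! i \<noteq> letter_g \<or> ?w ! (i + 1) \<noteq> letter_g \<or> ?w ! (i + 2) \<noteq> letter_g" if i: "i + 2 < length ?w" for i
  proof -
    have alt: "fst (v ! j) \<noteq> fst (v ! Suc j)" if "Suc j < length v" for j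
      using v(1) that by (rule successively_nth)
    consider "i < length a" | "length a \<le> i" "i + 1 < length a + length v" | "i + 1 = length a + length v"
      | "i + 1 > length a + length v" by linarith
    then show ?thesis
    proof cases
      case 1
      then have "a = [(True, True)]" "i = 0" by (auto simp: a_def split: if_splits)
      then show ?thesis by simp
    next
      case 2
      then obtain j where j: "i = length a + j" "Suc j < length v" using le_Suc_ex by force
      then have "?w ! i = v ! j" "?w ! (i + 1) = v ! Suc j" by (auto simp: nth_append)
      then show ?thesis using alt[OF j(2)] by auto
    next
      case 3
      then have "b = [(True, True)]" "?w ! (i + 2) = b ! 0"
        using i by (auto simp: b_def nth_append split: if_splits)
      then show ?thesis by auto
    next
      case 4
      then show ?thesis using i by (auto simp: b_def split: if_splits)
    qed
  qed
  have red: "reduced v" using v(1) by (rule alternating_imp_reduced)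
  have "filler ?w"
    unfolding filler_def
  proof (intro conjI allI impI)
    show "reduced ?w"
      using red x v(2) by (auto simp: a_def b_def successively_append_iff successively_Cons linv_def)
    show "fst (hd ?w)" "fst (last ?w)" using v(2) by (auto simp: a_def b_def)
  qed (use nth in auto)
  then show thesis by (rule that)
qed

text \<open>Ignoring the second component of the decoded pair makes every filler appear infinitely often.\<close>
definition filler_enum :: "nat \<Rightarrow> letter list" where
  "filler_enum n = (let w = from_nat (fst (prod_decode n)) in if filler w then w else [(True, True)])"

lemma filler_filler_enum: "filler (filler_enum n)"
  by (simp add: filler_enum_def Let_def filler_singleton)

lemma filler_enum_frequently:
  assumes "filler w"
  obtains n where "n \<ge> M" "filler_enum n = w"
proof
  show "prod_encode (to_nat w, M) \<ge> M" by (rule le_prod_encode_2)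
  show "filler_enum (prod_encode (to_nat w, M)) = w"
    using assms by (simp add: filler_enum_def)
qed

text \<open>The bit \<open>\<sigma> n\<close> is stored in the choice between \<open>h\<close> and \<open>h\<inverse>\<close>, so that block positions
  do not depend on \<open>\<sigma>\<close> and the bit can be read off at a known place.\<close>
definition coded_word :: "(nat \<Rightarrow> bool) \<Rightarrow> nat \<Rightarrow> letter list" where
  "coded_word \<sigma> n = filler_enum n @ [letter_g] @ [(True, \<sigma> n)]"

definition coded_seq :: "(nat \<Rightarrow> bool) \<Rightarrow> nat \<Rightarrow> letter" where
  "coded_seq \<sigma> = concat_seq (blocks (coded_word \<sigma>))"

lemma filler_coded_word: "filler (coded_word \<sigma> n)"
  unfolding coded_word_def
  by (intro filler_append filler_filler_enum filler_singleton) simp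

lemma reduced_seq_coded_seq: "reduced_seq (coded_seq \<sigma>)"
  unfolding coded_seq_def by (rule reduced_seq_block_seq) (rule filler_coded_word)

lemma inj_coded_seq: "inj coded_seq"
proof (rule injI, rule ext)
  fix \<sigma> \<tau> n assume eq: "coded_seq \<sigma> = coded_seq \<tau>"
  have len: "length (coded_word \<rho> n) = length (filler_enum n) + 2" for \<rho> n
    by (simp add: coded_word_def)
  have pos: "concat_len (blocks (coded_word \<sigma>)) n = concat_len (blocks (coded_word \<tau>)) n" for n
    by (induction n) (auto simp: blocks_def len)
  have "coded_seq \<rho> (concat_len (blocks (coded_word \<rho>)) n + (n + 3) + (length (filler_enum n) + 1)) = (True, \<rho> n)"
    for \<rho>
    unfolding coded_seq_def
    by (subst block_seq_W[OF filler_coded_word]) (simp_all add: len coded_word_def nth_append)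
  from this[of \<sigma>] this[of \<tau>] show "\<sigma> n = \<tau> n" by (simp add: pos eq)
qed

lemma coded_seq_frequently:
  assumes v: "alternating v" "v \<noteq> []" and x: "x \<noteq> linv (last v)"
  shows "\<exists>N\<ge>M. occurs_at (v @ [x]) (coded_seq \<sigma>) N"
proof -
  obtain a b where sep: "filler (a @ (v @ [x]) @ b)"
    using filler_extension[OF assms] .
  obtain n where n: "n \<ge> M" "filler_enum n = a @ (v @ [x]) @ b"
    using filler_enum_frequently[OF sep] .
  define L where "L = concat_len (blocks (coded_word \<sigma>)) n"
  have "coded_seq \<sigma> (L + (n + 3) + length a + i) = (v @ [x]) ! i" if "i < length (v @ [x])" for i
  proof -
    have "coded_seq \<sigma> (L + (n + 3) + (length a + i)) = coded_word \<sigma> n ! (length a + i)"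
      unfolding coded_seq_def L_def using that
      by (intro block_seq_W filler_coded_word) (simp add: coded_word_def n)
    also have "\<dots> = (v @ [x]) ! i"
      using that by (simp add: coded_word_def n nth_append)
    finally show ?thesis by (simp add: add.assoc)
  qed
  then have "occurs_at (v @ [x]) (coded_seq \<sigma>) (L + (n + 3) + length a)"
    unfolding occurs_at_def by blast
  moreover have "L + (n + 3) + length a \<ge> M" using n by simp
  ultimately show ?thesis by blast
qed

lemma coded_seq_nonrecurrent:
  "\<exists>n\<ge>k. \<forall>j>n. \<exists>i\<le>n - k. coded_seq \<sigma> (j + i) \<noteq> coded_seq \<sigma> (k + i)"
  unfolding coded_seq_def by (rule block_seq_nonrecurrent) (rule filler_coded_word)

section \<open>Distortion of disc automorphisms\<close>

text \<open>The function \<open>d\<close> is the modulus of the derivative. Both identities hold for every conformal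
  automorphism of the disc and are preserved by composition, which gives the distortion of arbitrary
  words without computing their coefficients.\<close>
definition conformal :: "(complex \<Rightarrow> complex) \<Rightarrow> bool" where
  "conformal f \<longleftrightarrow> (\<exists>d. \<forall>z\<in>cball 0 1. d z > 0 \<and> 1 - (norm (f z))\<^sup>2 = d z * (1 - (norm z)\<^sup>2) \<and>
     (\<forall>y\<in>cball 0 1. (dist (f z) (f y))\<^sup>2 = d z * d y * (dist z y)\<^sup>2))"

lemma conformalE:
  assumes "conformal f"
  obtains d where "\<And>z. z \<in> cball 0 1 \<Longrightarrow> d z > 0"
    "\<And>z. z \<in> cball 0 1 \<Longrightarrow> 1 - (norm (f z))\<^sup>2 = d z * (1 - (norm z)\<^sup>2)"
    "\<And>z y. \<lbrakk>z \<in> cball 0 1; y \<in> cball 0 1\<rbrakk> \<Longrightarrow> (dist (f z) (f y))\<^sup>2 = d z * d y * (dist z y)\<^sup>2"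
  using assms unfolding conformal_def by metis

lemma square_le_1_iff_norm: "(norm (z::complex))\<^sup>2 \<le> 1 \<longleftrightarrow> norm z \<le> 1"
  using power2_le_iff_abs_le[of 1 "norm z"] by simp

lemma conformal_ball:
  assumes "conformal f"
  shows "z \<in> cball 0 1 \<Longrightarrow> f z \<in> cball 0 1" "z \<in> ball 0 1 \<Longrightarrow> f z \<in> ball 0 1"
    "z \<in> sphere 0 1 \<Longrightarrow> f z \<in> sphere 0 1"
proof -
  obtain d where d: "\<And>z. z \<in> cball 0 1 \<Longrightarrow> d z > 0 \<and> 1 - (norm (f z))\<^sup>2 = d z * (1 - (norm z)\<^sup>2)"
    using assms unfolding conformal_def by blast
  { assume z: "z \<in> cball 0 1"
    then have "(norm z)\<^sup>2 \<le> 1" by (simp add: square_le_1_iff_norm)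
    then have "1 - (norm (f z))\<^sup>2 \<ge> 0" using d[OF z] by simp
    then show "f z \<in> cball 0 1" using square_le_1_iff_norm[of "f z"] by simp }
  { assume z: "z \<in> ball 0 1"
    then have "(norm z)\<^sup>2 < 1" by (simp add: power_less_one_iff abs_square_less_1)
    moreover have "z \<in> cball 0 1" using z by simp
    ultimately have "1 - (norm (f z))\<^sup>2 > 0" using d[of z] by simp
    then show "f z \<in> ball 0 1" by (simp add: abs_square_less_1) }
  { assume z: "z \<in> sphere 0 1"
    then have "1 - (norm (f z))\<^sup>2 = 0" using d[of z] by simp
    then show "f z \<in> sphere 0 1" by (simp add: power2_eq_1_iff) (smt (verit) norm_ge_zero) }
qed

lemma conformal_compose:
  assumes "conformal f" "conformal h"
  shows "conformal (\<lambda>z. f (h z))"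
proof -
  obtain d where d: "\<And>z. z \<in> cball 0 1 \<Longrightarrow> d z > 0 \<and> 1 - (norm (f z))\<^sup>2 = d z * (1 - (norm z)\<^sup>2) \<and>
     (\<forall>y\<in>cball 0 1. (dist (f z) (f y))\<^sup>2 = d z * d y * (dist z y)\<^sup>2)"
    using assms(1) unfolding conformal_def by blast
  obtain e where e: "\<And>z. z \<in> cball 0 1 \<Longrightarrow> e z > 0 \<and> 1 - (norm (h z))\<^sup>2 = e z * (1 - (norm z)\<^sup>2) \<and>
     (\<forall>y\<in>cball 0 1. (dist (h z) (h y))\<^sup>2 = e z * e y * (dist z y)\<^sup>2)"
    using assms(2) unfolding conformal_def by blast
  show ?thesis unfolding conformal_def
  proof (intro exI[of _ "\<lambda>z. d (h z) * e z"] ballI conjI)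
    fix z :: complex assume z: "z \<in> cball 0 1"
    have hz: "h z \<in> cball 0 1" using conformal_ball(1)[OF assms(2) z] .
    show "d (h z) * e z > 0" using d[OF hz] e[OF z] by simp
    show "1 - (norm (f (h z)))\<^sup>2 = d (h z) * e z * (1 - (norm z)\<^sup>2)" using d[OF hz] e[OF z] by simp
    fix y :: complex assume y: "y \<in> cball 0 1"
    have hy: "h y \<in> cball 0 1" using conformal_ball(1)[OF assms(2) y] .
    show "(dist (f (h z)) (f (h y)))\<^sup>2 = d (h z) * e z * (d (h y) * e y) * (dist z y)\<^sup>2"
      using d[OF hz] e[OF z] hy y by simp
  qed
qed

lemma conformal_id: "conformal (\<lambda>z. z)"
  unfolding conformal_def by (rule exI[of _ "\<lambda>_. 1"]) simp

lemma conformal_norm_preimage_zero: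
  assumes f: "conformal f" and w: "w \<in> ball 0 1" "f w = 0"
  shows "norm w = norm (f 0)"
proof -
  obtain d where d: "\<And>z. z \<in> cball 0 1 \<Longrightarrow> d z > 0"
      "\<And>z. z \<in> cball 0 1 \<Longrightarrow> 1 - (norm (f z))\<^sup>2 = d z * (1 - (norm z)\<^sup>2)"
      "\<And>z y. \<lbrakk>z \<in> cball 0 1; y \<in> cball 0 1\<rbrakk> \<Longrightarrow> (dist (f z) (f y))\<^sup>2 = d z * d y * (dist z y)\<^sup>2"
    using conformalE[OF f] by blast
  have w': "w \<in> cball 0 1" using w by simp
  have 1: "1 = d w * (1 - (norm w)\<^sup>2)" using d(2)[OF w'] w by simp
  have 2: "1 - (norm (f 0))\<^sup>2 = d 0" using d(2)[of 0] by simp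
  have "(dist (f 0) (f w))\<^sup>2 = d 0 * d w * (dist 0 w)\<^sup>2" using d(3)[of 0 w] w' by simp
  then have "(norm (f 0))\<^sup>2 = d 0 * d w * (norm w)\<^sup>2" using w by simp
  moreover have "d w * (norm w)\<^sup>2 = d w - 1" using 1 by (simp add: algebra_simps)
  ultimately have "(norm (f 0))\<^sup>2 = d 0 * (d w - 1)" by (simp add: mult.assoc)
  then have "d 0 * d w = 1" using 2 by (simp add: algebra_simps)
  then have "(1 - (norm (f 0))\<^sup>2) * d w = 1" by (simp only: 2)
  moreover have "d w \<noteq> 0" using d(1)[OF w'] by simp
  ultimately have "1 - (norm (f 0))\<^sup>2 = 1 - (norm w)\<^sup>2"
    using 1 by (metis mult.commute mult_right_cancel)
  then show ?thesis by (simp add: power2_eq_iff_nonneg)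
qed

text \<open>Applying the distortion identity to \<open>\<zeta>\<close> and \<open>w = f\<inverse> 0\<close> shows that the derivative at \<open>\<zeta>\<close> is
  \<open>(1 - (norm w)\<^sup>2) / (dist \<zeta> w)\<^sup>2\<close>, the Poisson kernel. So \<open>f\<close> contracts the part of the circle away from
  \<open>w\<close> to the vicinity of \<open>f 0\<close> as soon as \<open>f 0\<close> is close to the circle.\<close>
lemma conformal_boundary_estimate:
  assumes f: "conformal f" and w: "w \<in> ball 0 1" "f w = 0"
    and \<zeta>: "\<zeta> \<in> sphere 0 1" and \<delta>: "\<delta> > 0" "dist \<zeta> w \<ge> \<delta>"
  shows "dist (f \<zeta>) (f 0) \<le> (1 - (norm (f 0))\<^sup>2) / \<delta>"
proof -
  obtain d where d: "\<And>z. z \<in> cball 0 1 \<Longrightarrow> d z > 0"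
      "\<And>z. z \<in> cball 0 1 \<Longrightarrow> 1 - (norm (f z))\<^sup>2 = d z * (1 - (norm z)\<^sup>2)"
      "\<And>z y. \<lbrakk>z \<in> cball 0 1; y \<in> cball 0 1\<rbrakk> \<Longrightarrow> (dist (f z) (f y))\<^sup>2 = d z * d y * (dist z y)\<^sup>2"
    using conformalE[OF f] by blast
  have in_cball: "w \<in> cball 0 1" "\<zeta> \<in> cball 0 1" "(0::complex) \<in> cball 0 1" using w \<zeta> by auto
  define \<rho> where "\<rho> = 1 - (norm (f 0))\<^sup>2"
  have nw: "norm w = norm (f 0)" using conformal_norm_preimage_zero[OF f w] .
  have d0: "d 0 = \<rho>" using d(2)[OF in_cball(3)] by (simp add: \<rho>_def)
  then have pos: "\<rho> > 0" using d(1)[OF in_cball(3)] by simp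
  have dw: "d w = 1 / \<rho>" using d(2)[OF in_cball(1)] w nw pos by (simp add: field_simps \<rho>_def)
  have "1 = (dist (f \<zeta>) (f w))\<^sup>2"
    using conformal_ball(3)[OF f \<zeta>] w by (simp add: dist_norm)
  also have "\<dots> = d \<zeta> * d w * (dist \<zeta> w)\<^sup>2" using d(3)[OF in_cball(2,1)] .
  finally have "d \<zeta> * (dist \<zeta> w)\<^sup>2 = \<rho>" using dw pos by (simp add: field_simps)
  moreover have "\<delta>\<^sup>2 \<le> (dist \<zeta> w)\<^sup>2" using \<delta> by (intro power_mono) auto
  ultimately have dz: "d \<zeta> * \<delta>\<^sup>2 \<le> \<rho>"
    using d(1)[OF in_cball(2)] by (metis less_eq_real_def mult_left_mono)
  have "(dist (f \<zeta>) (f 0))\<^sup>2 = d \<zeta> * d 0 * (dist \<zeta> 0)\<^sup>2" using d(3)[OF in_cball(2,3)] .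
  also have "\<dots> = d \<zeta> * \<rho>" using \<zeta> d0 by simp
  also have "\<dots> \<le> (\<rho> / \<delta>)\<^sup>2"
    using dz pos \<delta> by (simp add: field_simps power2_eq_square)
  finally have "dist (f \<zeta>) (f 0) \<le> \<rho> / \<delta>" by (rule power2_le_imp_le) (use pos \<delta> in simp)
  then show ?thesis by (simp add: \<rho>_def)
qed

text \<open>Disc automorphisms preserve pseudo-hyperbolic distance, which is comparable to Euclidean distance
  on compact subsets of the disc.\<close>
lemma conformal_separation:
  assumes f: "conformal f" and b: "b \<in> ball 0 1" "\<delta> \<ge> 0" "norm b \<ge> \<delta>"
    and r: "norm (f 0) \<le> r" "norm (f b) \<le> r" "r < 1"
  shows "dist (f 0) (f b) \<ge> (1 - r\<^sup>2) * \<delta>"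
proof -
  obtain d where d: "\<And>z. z \<in> cball 0 1 \<Longrightarrow> d z > 0"
      "\<And>z. z \<in> cball 0 1 \<Longrightarrow> 1 - (norm (f z))\<^sup>2 = d z * (1 - (norm z)\<^sup>2)"
      "\<And>z y. \<lbrakk>z \<in> cball 0 1; y \<in> cball 0 1\<rbrakk> \<Longrightarrow> (dist (f z) (f y))\<^sup>2 = d z * d y * (dist z y)\<^sup>2"
    using conformalE[OF f] by blast
  have b': "b \<in> cball 0 1" using b by simp
  have r2: "r\<^sup>2 \<le> 1" "(norm (f 0))\<^sup>2 \<le> r\<^sup>2" "(norm (f b))\<^sup>2 \<le> r\<^sup>2"
    using r by (auto intro!: power_mono power_le_one order_trans[OF norm_ge_zero r(1)])
  have d0: "d 0 \<ge> 1 - r\<^sup>2" using d(2)[of 0] r2 by simp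
  have db: "d b \<ge> 1 - r\<^sup>2"
  proof -
    have "1 - r\<^sup>2 \<le> d b * (1 - (norm b)\<^sup>2)" using d(2)[OF b'] r2 by simp
    also have "\<dots> \<le> d b * 1" using d(1)[OF b'] by (intro mult_left_mono) auto
    finally show ?thesis by simp
  qed
  have "((1 - r\<^sup>2) * \<delta>)\<^sup>2 = (1 - r\<^sup>2) * (1 - r\<^sup>2) * \<delta>\<^sup>2" by (simp add: power2_eq_square)
  also have "\<dots> \<le> d 0 * d b * (norm b)\<^sup>2"
    using d0 db r2 b by (intro mult_mono power_mono) auto
  also have "\<dots> = (dist (f 0) (f b))\<^sup>2" using d(3)[of 0 b] b' by simp
  finally show ?thesis by (rule power2_le_imp_le) simp
qed

section \<open>Ping-pong\<close>

text \<open>The dynamics of a two-generator Schottky group: \<open>D x\<close> and \<open>E x\<close> are the closed and the open half-disc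
  into which the letter \<open>x\<close> maps. The last assumption expresses that the arcs of the two generators
  alternate around the circle; it is the only place where their cyclic order enters.\<close>
locale schottky =
  fixes f :: "letter \<Rightarrow> complex \<Rightarrow> complex" and D E :: "letter \<Rightarrow> complex set"
  assumes conf: "conformal (f x)"
    and cont: "continuous_on (cball 0 1) (f x)"
    and inv: "z \<in> cball 0 1 \<Longrightarrow> f (linv x) (f x z) = z"
    and pairing: "z \<in> cball 0 1 \<Longrightarrow> f x z \<in> D x \<longleftrightarrow> z \<notin> E (linv x)"
    and disj: "x \<noteq> y \<Longrightarrow> D x \<inter> D y = {}"
    and E_subset: "E x \<subseteq> D x" and D_subset: "D x \<subseteq> cball 0 1"
    and closed_D: "closed (D x)" and open_E: "openin (top_of_set (cball 0 1)) (E x)"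
    and zero: "0 \<notin> D x"
    and boundary: "\<exists>\<zeta>\<in>sphere 0 1. \<zeta> \<in> D x - E x"
    and separation: "\<lbrakk>connected U; U \<subseteq> sphere 0 1; m \<in> D x \<inter> sphere 0 1; m \<notin> U;
       m' \<in> D (linv x) \<inter> sphere 0 1; m' \<notin> U; fst y \<noteq> fst x\<rbrakk> \<Longrightarrow> U \<inter> D y = {} \<or> U \<inter> D (linv y) = {}"
begin

abbreviation act :: "letter list \<Rightarrow> complex \<Rightarrow> complex" where
  "act w z \<equiv> foldr f w z"

lemma conformal_act: "conformal (act w)"
proof (induction w)
  case Nil
  then show ?case using conformal_id by (simp add: id_def)
next
  case (Cons x w)
  then show ?case using conformal_compose[OF conf Cons] by (simp add: comp_def)
qed

lemmas act_cball = conformal_ball(1)[OF conformal_act]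
  and act_ball = conformal_ball(2)[OF conformal_act]
  and act_sphere = conformal_ball(3)[OF conformal_act]

lemma norm_act_le [simp]: "norm z \<le> 1 \<Longrightarrow> norm (act w z) \<le> 1"
  using act_cball[of z w] by simp

lemma continuous_act: "continuous_on (cball 0 1) (act w)"
proof (induction w)
  case (Cons x w)
  have "continuous_on (cball 0 1) (\<lambda>z. f x (act w z))"
    by (rule continuous_on_compose2[OF cont Cons]) auto
  then show ?case by (simp add: comp_def)
qed (simp add: id_def)

lemma act_winv: "z \<in> cball 0 1 \<Longrightarrow> act (winv w) (act w z) = z"
proof (induction w arbitrary: z)
  case (Cons x w)
  then show ?case using inv[of "act w z" x] act_cball[OF Cons.prems, of w] by simp
qed simp

lemma act_winv': "z \<in> cball 0 1 \<Longrightarrow> act w (act (winv w) z) = z"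
  using act_winv[of z "winv w"] by simp

lemma f_cball: "z \<in> cball 0 1 \<Longrightarrow> f x z \<in> cball 0 1"
  using conformal_ball(1)[OF conf] by blast

lemma pairing_E: assumes "z \<in> cball 0 1" shows "f x z \<in> E x \<longleftrightarrow> z \<notin> D (linv x)"
  using pairing[of "f x z" "linv x"] inv[OF assms] f_cball[OF assms] by simp

lemma ping_pong_aux:
  assumes "z \<in> cball 0 1" "reduced w" "w \<noteq> []"
  shows "(z \<notin> E (linv (last w)) \<longrightarrow> act w z \<in> D (hd w)) \<and> (z \<notin> D (linv (last w)) \<longrightarrow> act w z \<in> E (hd w))"
  using assms(2,3)
proof (induction w)
  case (Cons x w)
  show ?case
  proof (cases "w = []")
    case True
    then show ?thesis using pairing pairing_E assms(1) by simp
  next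
    case False
    have c: "act w z \<in> cball 0 1" using act_cball[OF assms(1)] .
    have ne: "linv x \<noteq> hd w" and red: "reduced w" using Cons.prems False by (auto simp: successively_Cons)
    have *: "act (x # w) z \<in> D x \<and> act (x # w) z \<in> E x" if "act w z \<in> D (hd w)"
    proof -
      have "act w z \<notin> D (linv x)" using that disj[OF ne] by blast
      then show ?thesis using pairing_E[OF c, of x] E_subset[of x] by auto
    qed
    show ?thesis using * Cons.IH[OF red False] E_subset[of "hd w"] False by auto
  qed
qed simp

lemmas ping_pong_D = ping_pong_aux[THEN conjunct1, rule_format]
lemmas ping_pong_E = ping_pong_aux[THEN conjunct2, rule_format]

lemma ping_pong_word:
  assumes "reduced (w @ [x])" "z \<in> D x" "w \<noteq> []"
  shows "act w z \<in> E (hd w)"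
proof (rule ping_pong_E)
  show "z \<notin> D (linv (last w))"
    using assms disj[of x "linv (last w)"] by (auto simp: successively_append_iff)
  show "z \<in> cball 0 1" using assms D_subset by blast
qed (use assms in \<open>auto simp: successively_append_iff\<close>)

lemma ping_pong_back:
  assumes "reduced w" "w \<noteq> []" "z \<in> cball 0 1" "z \<notin> E (hd w)"
  shows "act (winv w) z \<in> D (linv (last w))"
  using ping_pong_D[of z "winv w"] assms by (simp add: hd_winv last_winv)

text \<open>A shortest word with a given action cannot contain a letter next to its inverse.\<close>
lemma reduced_representative:
  obtains t where "reduced t" "\<And>z. z \<in> cball 0 1 \<Longrightarrow> act t z = act w z"
proof -
  define P where "P = (\<lambda>t. \<forall>z\<in>cball 0 1. act t z = act w z)"
  have "P w" by (simp add: P_def)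
  then obtain t where t: "P t" "\<And>s. P s \<Longrightarrow> length t \<le> length s"
    using exists_least_lemma ex_has_least_nat[of P w length] by blast
  have "reduced t"
  proof (rule ccontr)
    assume "\<not> reduced t"
    then obtain i where i: "Suc i < length t" "t ! Suc i = linv (t ! i)"
      by (auto simp: successively_conv_nth)
    then have split: "t = take i t @ [t ! i, linv (t ! i)] @ drop (Suc (Suc i)) t"
      by (metis Cons_nth_drop_Suc Suc_lessD append_Cons append_Nil append_take_drop_id)
    have "P (take i t @ drop (Suc (Suc i)) t)"
      unfolding P_def
    proof
      fix z :: complex assume z: "z \<in> cball 0 1"
      define u where "u = act (drop (Suc (Suc i)) t) z"
      have u: "u \<in> cball 0 1" using z by (simp add: u_def del: mem_cball)
      have "act w z = act t z" using t(1) z by (simp add: P_def)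
      also have "\<dots> = act (take i t @ [t ! i, linv (t ! i)] @ drop (Suc (Suc i)) t) z"
        using split by simp
      also have "\<dots> = act (take i t) (f (t ! i) (f (linv (t ! i)) u))" by (simp add: u_def)
      also have "f (t ! i) (f (linv (t ! i)) u) = u" using inv[OF u, of "linv (t ! i)"] by simp
      finally show "act (take i t @ drop (Suc (Suc i)) t) z = act w z" by (simp add: u_def)
    qed
    from t(2)[OF this] i(1) show False by simp
  qed
  then show thesis using that t(1) by (auto simp: P_def)
qed

section \<open>Limit points coded by reduced sequences\<close>

text \<open>There are only four regions, they are compact, pairwise disjoint and avoid the origin.\<close>
lemma uniform_separation:
  obtains \<delta> where "\<delta> > 0" "\<And>x z. z \<in> D x \<Longrightarrow> \<delta> \<le> norm z"
    "\<And>x y z w. \<lbrakk>x \<noteq> y; z \<in> D x; w \<in> D y\<rbrakk> \<Longrightarrow> \<delta> \<le> dist z w"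
proof -
  have compact: "compact (D x)" for x
    using closed_D D_subset bounded_subset[OF bounded_cball] compact_eq_bounded_closed by blast
  have "\<exists>d>0. \<forall>z\<in>D x. d \<le> norm z" for x
    using separate_compact_closed[of "{0}" "D x"] closed_D zero by (auto simp: dist_norm)
  then obtain a where a: "\<And>x. a x > 0" "\<And>x z. z \<in> D x \<Longrightarrow> a x \<le> norm z" by metis
  have "\<exists>d>0. x \<noteq> y \<longrightarrow> (\<forall>z\<in>D x. \<forall>w\<in>D y. d \<le> dist z w)" for x y
  proof (cases "x = y")
    case False
    then show ?thesis using separate_compact_closed[OF compact closed_D disj[OF False]] by blast
  qed (auto intro: exI[of _ 1])
  then obtain b where b: "\<And>x y. b x y > 0"
    "\<And>x y z w. \<lbrakk>x \<noteq> y; z \<in> D x; w \<in> D y\<rbrakk> \<Longrightarrow> b x y \<le> dist z w" by metis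
  define \<delta> where "\<delta> = Min (range a \<union> range (case_prod b))"
  have fin: "finite (range a \<union> range (case_prod b))" by simp
  show thesis
  proof
    show "\<delta> > 0" unfolding \<delta>_def using a(1) b(1) by (subst Min_gr_iff) auto
    show "\<delta> \<le> norm z" if "z \<in> D x" for x z
    proof -
      have "\<delta> \<le> a x" unfolding \<delta>_def by (rule Min_le[OF fin]) simp
      then show ?thesis using a(2)[OF that] by simp
    qed
    show "\<delta> \<le> dist z w" if "x \<noteq> y" "z \<in> D x" "w \<in> D y" for x y z w
    proof -
      have "b x y \<in> range a \<union> range (case_prod b)" by (metis UnI2 case_prod_conv rangeI)
      then have "\<delta> \<le> b x y" unfolding \<delta>_def by (rule Min_le[OF fin])
      then show ?thesis using b(2)[OF that] by simp
    qed
  qed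
qed

lemma zero_E: "0 \<notin> E x"
  using zero E_subset by blast

abbreviation C :: "letter \<Rightarrow> complex set" where
  "C x \<equiv> D x \<inter> sphere 0 1"

definition prefix_word :: "(nat \<Rightarrow> letter) \<Rightarrow> nat \<Rightarrow> letter list" where
  "prefix_word p n = map p [0..<n]"

definition cylinder :: "(nat \<Rightarrow> letter) \<Rightarrow> nat \<Rightarrow> complex set" where
  "cylinder p n = act (prefix_word p n) ` C (p n)"

definition codes :: "(nat \<Rightarrow> letter) \<Rightarrow> complex \<Rightarrow> bool" where
  "codes p z \<longleftrightarrow> (\<forall>n. z \<in> cylinder p n)"

lemma prefix_word_simps [simp]: "prefix_word p 0 = []" "length (prefix_word p n) = n"
   "prefix_word p (Suc n) = prefix_word p n @ [p n]"
  by (auto simp: prefix_word_def)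

lemma prefix_add: "prefix_word p (n + m) = prefix_word p n @ prefix_word (\<lambda>i. p (n + i)) m"
  by (induction m) auto

lemma reduced_prefix: "reduced_seq p \<Longrightarrow> reduced (prefix_word p n)"
  by (auto simp: reduced_seq_def successively_conv_nth prefix_word_def)

lemma reduced_seq_shift: "reduced_seq p \<Longrightarrow> reduced_seq (\<lambda>i. p (n + i))"
  by (auto simp: reduced_seq_def)

lemma hd_prefix: "n > 0 \<Longrightarrow> hd (prefix_word p n) = p 0"
  by (simp add: prefix_word_def hd_map)

lemma last_prefix: "n > 0 \<Longrightarrow> last (prefix_word p n) = p (n - 1)"
  by (cases n) auto

text \<open>For \<open>n < m\<close> the two orbit points differ by the image of a point \<open>b\<close> of some region, and
  \<open>norm b \<ge> \<delta>\<close>. So orbit points that stay in a fixed smaller disc are uniformly separated from each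
  other, and by compactness there are only finitely many of them.\<close>
lemma orbit_norm_tendsto_1:
  assumes p: "reduced_seq p"
  shows "(\<lambda>n. norm (act (prefix_word p n) 0)) \<longlonglongrightarrow> 1"
proof -
  define a where "a n = act (prefix_word p n) 0" for n
  have lt1: "norm (a n) < 1" for n using act_ball[of 0 "prefix_word p n"] by (simp add: a_def)
  obtain \<delta> where \<delta>: "\<delta> > 0" "\<And>x z. z \<in> D x \<Longrightarrow> \<delta> \<le> norm z"
    using uniform_separation by metis
  have "finite {n. norm (a n) \<le> r}" if r: "0 \<le> r" "r < 1" for r
  proof -
    define S where "S = {n. norm (a n) \<le> r}"
    define \<eta> where "\<eta> = (1 - r\<^sup>2) * \<delta>"
    have "r\<^sup>2 < 1" using r by (simp add: abs_square_less_1)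
    then have \<eta>: "\<eta> > 0" using \<delta> by (simp add: \<eta>_def)
    have sep: "dist (a n) (a m) \<ge> \<eta>" if nm: "n < m" "n \<in> S" "m \<in> S" for n m
    proof -
      obtain k where k: "m = n + Suc k" using less_imp_Suc_add[OF nm(1)] by auto
      define q where "q = (\<lambda>i. p (n + i))"
      define b where "b = act (prefix_word q (Suc k)) 0"
      have "b \<in> E (hd (prefix_word q (Suc k)))"
        unfolding b_def
        by (rule ping_pong_E) (use zero reduced_prefix[OF reduced_seq_shift[OF p]] in \<open>auto simp: q_def simp del: prefix_word_simps(3)\<close>, simp)
      then have nb: "\<delta> \<le> norm b" using E_subset \<delta>(2) by blast
      have am: "a m = act (prefix_word p n) b" by (simp add: a_def b_def k q_def prefix_add del: prefix_word_simps(3) add_Suc_right)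
      show ?thesis
        unfolding \<eta>_def am a_def[of n]
      proof (rule conformal_separation[OF conformal_act])
        show "b \<in> ball 0 1" unfolding b_def by (rule act_ball) simp
      qed (use nm nb \<delta> r am in \<open>auto simp: S_def a_def[of n]\<close>)
    qed
    then have sep': "dist (a n) (a m) \<ge> \<eta>" if "n \<noteq> m" "n \<in> S" "m \<in> S" for n m
      using that by (metis dist_commute linorder_neqE_nat)
    have inj: "inj_on a S"
      by (rule inj_onI) (metis sep' \<eta> dist_self not_le)
    have "uniform_discrete (a ` S)"
      unfolding uniform_discrete_def
    proof (intro exI[of _ \<eta>] conjI ballI impI)
      fix z w assume "z \<in> a ` S" "w \<in> a ` S" "dist z w < \<eta>"
      then show "z = w" using sep' by (metis image_iff not_le)
    qed (rule \<eta>)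
    moreover have "bounded (a ` S)"
      by (rule bounded_subset[OF bounded_cball[of 0 r]]) (auto simp: S_def)
    ultimately have "finite (a ` S)" using uniform_discrete_finite_iff by blast
    then show ?thesis using finite_image_iff[OF inj] by (simp add: S_def)
  qed
  note fin = this
  have "(\<lambda>n. norm (a n)) \<longlonglongrightarrow> 1"
  proof (rule order_tendstoI)
    fix r :: real assume "r < 1"
    then have "finite {n. norm (a n) \<le> max r 0}" by (intro fin) auto
    then have "\<forall>\<^sub>F n in cofinite. n \<notin> {n. norm (a n) \<le> max r 0}"
      by (simp add: eventually_cofinite)
    then show "\<forall>\<^sub>F n in sequentially. r < norm (a n)"
      unfolding cofinite_eq_sequentially by eventually_elim auto
  next
    fix r :: real assume "1 < r"
    then show "\<forall>\<^sub>F n in sequentially. norm (a n) < r"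
      using lt1 by (intro always_eventually) (auto intro: less_trans)
  qed
  then show ?thesis by (simp add: a_def)
qed

text \<open>The preimage of the origin under the first \<open>n\<close> letters lies in the region of the inverse of the
  last one, which is at a definite distance from the arc of the following letter.\<close>
lemma cylinder_near_orbit:
  assumes p: "reduced_seq p"
  obtains \<epsilon> where "\<epsilon> \<longlonglongrightarrow> 0"
    "\<And>n z. \<lbrakk>n > 0; z \<in> cylinder p n\<rbrakk> \<Longrightarrow> dist z (act (prefix_word p n) 0) \<le> \<epsilon> n"
proof -
  obtain \<delta> where \<delta>: "\<delta> > 0" "\<And>x y z w. \<lbrakk>x \<noteq> y; z \<in> D x; w \<in> D y\<rbrakk> \<Longrightarrow> \<delta> \<le> dist z w"
    using uniform_separation by metis
  define \<epsilon> where "\<epsilon> n = (1 - (norm (act (prefix_word p n) 0))\<^sup>2) / \<delta>" for n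
  show thesis
  proof
    have "(\<lambda>n. (1 - (norm (act (prefix_word p n) 0))\<^sup>2) / \<delta>) \<longlonglongrightarrow> (1 - 1\<^sup>2) / \<delta>"
      by (intro tendsto_intros orbit_norm_tendsto_1 p) (use \<delta> in simp)
    then show "\<epsilon> \<longlonglongrightarrow> 0" by (simp add: \<epsilon>_def[abs_def])
    fix n z assume n: "n > 0" and "z \<in> cylinder p n"
    then obtain \<zeta> where \<zeta>: "\<zeta> \<in> C (p n)" "z = act (prefix_word p n) \<zeta>" by (auto simp: cylinder_def)
    define w where "w = act (winv (prefix_word p n)) 0"
    have ne: "prefix_word p n \<noteq> []" using n by (metis length_0_conv less_numeral_extra(3) prefix_word_simps(2))
    have wD: "w \<in> D (linv (p (n - 1)))"
      unfolding w_def using ping_pong_back[OF reduced_prefix[OF p] ne, of 0] zero_E n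
      by (simp add: last_prefix)
    have wb: "w \<in> ball 0 1" unfolding w_def by (rule act_ball) simp
    have w0: "act (prefix_word p n) w = 0" unfolding w_def by (rule act_winv') simp
    have "p n \<noteq> linv (p (n - 1))" using p n by (cases n) (auto simp: reduced_seq_def)
    then have "\<delta> \<le> dist \<zeta> w" using \<delta>(2) wD \<zeta> by blast
    then show "dist z (act (prefix_word p n) 0) \<le> \<epsilon> n"
      unfolding \<epsilon>_def \<zeta>(2) using \<zeta>(1) \<delta>(1)
      by (intro conformal_boundary_estimate[OF conformal_act wb w0]) auto
  qed
qed

lemma f_cylinder_subset:
  assumes "x \<noteq> linv y"
  shows "f y ` C x \<subseteq> E y \<inter> sphere 0 1"
proof
  fix z assume "z \<in> f y ` C x"
  then obtain \<zeta> where \<zeta>: "z = f y \<zeta>" "\<zeta> \<in> C x" by blast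
  then have "\<zeta> \<notin> D (linv y)" using disj[OF assms] by blast
  then have "z \<in> E y" using \<zeta> pairing_E[of \<zeta> y] by auto
  moreover have "z \<in> sphere 0 1" using \<zeta> conformal_ball(3)[OF conf] by blast
  ultimately show "z \<in> E y \<inter> sphere 0 1" by blast
qed

lemma cylinder_Suc:
  assumes "reduced_seq p"
  shows "cylinder p (Suc n) \<subseteq> act (prefix_word p n) ` (E (p n) \<inter> sphere 0 1)"
proof -
  have "cylinder p (Suc n) = act (prefix_word p n) ` f (p n) ` C (p (Suc n))"
    by (auto simp: cylinder_def image_image)
  then show ?thesis using f_cylinder_subset[of "p (Suc n)" "p n"] assms
    by (simp add: reduced_seq_def image_mono)
qed

lemma cylinder_decreasing:
  assumes "reduced_seq p" "m \<le> n"
  shows "cylinder p n \<subseteq> cylinder p m"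
  using assms(2)
proof (induction rule: dec_induct)
  case (step n)
  have "cylinder p (Suc n) \<subseteq> cylinder p n"
    using cylinder_Suc[OF assms(1), of n] E_subset[of "p n"] by (auto simp: cylinder_def)
  then show ?case using step by blast
qed simp

lemma C_nonempty: "C x \<noteq> {}"
  using boundary[of x] by blast

lemma exists_coded:
  assumes p: "reduced_seq p"
  obtains z where "codes p z"
proof -
  have "compact (cylinder p n)" for n
    unfolding cylinder_def
  proof (rule compact_continuous_image)
    show "continuous_on (C (p n)) (act (prefix_word p n))"
      by (rule continuous_on_subset[OF continuous_act]) auto
    show "compact (C (p n))" using closed_D by (intro closed_Int_compact) auto
  qed
  then have "\<Inter>(range (cylinder p)) \<noteq> {}"
    using C_nonempty cylinder_decreasing[OF p] by (intro compact_nest) (auto simp: cylinder_def)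
  then show thesis using that by (auto simp: codes_def)
qed

lemma codes_sphere:
  assumes "codes p z"
  shows "z \<in> sphere 0 1"
proof -
  have "z \<in> cylinder p 0" using assms by (simp add: codes_def)
  then show ?thesis by (simp add: cylinder_def)
qed

lemma codes_shift:
  assumes "codes p z"
  shows "codes (\<lambda>i. p (n + i)) (act (winv (prefix_word p n)) z)"
  unfolding codes_def
proof
  fix m
  have "z \<in> cylinder p (n + m)" using assms by (simp add: codes_def)
  then obtain \<zeta> where \<zeta>: "\<zeta> \<in> C (p (n + m))" "z = act (prefix_word p n) (act (prefix_word (\<lambda>i. p (n + i)) m) \<zeta>)"
    by (auto simp: cylinder_def prefix_add)
  have "act (winv (prefix_word p n)) z = act (prefix_word (\<lambda>i. p (n + i)) m) \<zeta>"
    unfolding \<zeta>(2) by (rule act_winv) (use \<zeta> in auto)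
  then show "act (winv (prefix_word p n)) z \<in> cylinder (\<lambda>i. p (n + i)) m"
    using \<zeta> by (auto simp: cylinder_def)
qed

lemma codes_letter:
  assumes "codes p z"
  shows "act (winv (prefix_word p n)) z \<in> C (p n)"
proof -
  have "act (winv (prefix_word p n)) z \<in> cylinder (\<lambda>i. p (n + i)) 0"
    using codes_shift[OF assms] by (simp add: codes_def)
  then show ?thesis by (simp add: cylinder_def)
qed

text \<open>The regions of distinct letters are disjoint, so a point of the circle determines its letters one
  after the other.\<close>
lemma codes_word:
  assumes "codes p z" "reduced_seq p" "reduced (w @ [x])" "z = act w \<zeta>" "\<zeta> \<in> C x"
  shows "occurs_at (w @ [x]) p 0"
  using assms
proof (induction w arbitrary: p z)
  case Nil
  have "z \<in> C (p 0)" using codes_letter[OF Nil.prems(1), of 0] by simp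
  then have "x = p 0" using Nil.prems disj[of x "p 0"] by auto
  then show ?case by (simp add: occurs_at_def)
next
  case (Cons y w)
  have c: "act w \<zeta> \<in> cball 0 1" using Cons.prems by auto
  have "z \<in> E y" using ping_pong_word[of "y # w" x \<zeta>] Cons.prems by simp
  moreover have "z \<in> D (p 0)" using codes_letter[OF Cons.prems(1), of 0] by simp
  ultimately have y: "y = p 0" using E_subset[of y] disj[of y "p 0"] by blast
  have z': "act (winv (prefix_word p 1)) z = act w \<zeta>"
    using Cons.prems(4) inv[OF c, of y] y by simp
  have "occurs_at (w @ [x]) (\<lambda>i. p (1 + i)) 0"
  proof (rule Cons.IH)
    show "codes (\<lambda>i. p (1 + i)) (act w \<zeta>)" using codes_shift[OF Cons.prems(1), of 1] z' by simp
    show "reduced_seq (\<lambda>i. p (1 + i))" using Cons.prems(2) by (rule reduced_seq_shift)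
  qed (use Cons.prems in \<open>auto simp: successively_Cons\<close>)
  then show ?case using y by (auto simp: occurs_at_def nth_Cons split: nat.split)
qed

lemma codes_inj:
  assumes "codes p z" "codes q z" "reduced_seq p" "reduced_seq q"
  shows "p = q"
proof
  fix n
  have "z \<in> cylinder p n" using assms by (simp add: codes_def)
  then obtain \<zeta> where \<zeta>: "z = act (prefix_word p n) \<zeta>" "\<zeta> \<in> C (p n)" by (auto simp: cylinder_def)
  have "reduced (prefix_word p n @ [p n])" using reduced_prefix[OF assms(3), of "Suc n"] by simp
  from codes_word[OF assms(2,4) this \<zeta>] show "p n = q n"
    by (auto simp: occurs_at_def nth_append dest: spec[of _ n])
qed

lemma cylinder_shrinks:
  assumes p: "reduced_seq p" "codes p z" and V: "openin (top_of_set (sphere 0 1)) V" "z \<in> V"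
  obtains N where "\<And>n. n \<ge> N \<Longrightarrow> cylinder p n \<subseteq> V"
proof -
  obtain \<epsilon> where \<epsilon>: "\<epsilon> \<longlonglongrightarrow> 0" "\<And>n z. \<lbrakk>n > 0; z \<in> cylinder p n\<rbrakk> \<Longrightarrow> dist z (act (prefix_word p n) 0) \<le> \<epsilon> n"
    using cylinder_near_orbit[OF p(1)] by blast
  obtain e where e: "e > 0" "ball z e \<inter> sphere 0 1 \<subseteq> V"
    using V by (metis openin_contains_ball)
  have "\<forall>\<^sub>F n in sequentially. \<epsilon> n < e / 2" using e by (intro order_tendstoD(2)[OF \<epsilon>(1)]) simp
  then obtain N where N: "\<And>n. n \<ge> N \<Longrightarrow> \<epsilon> n < e / 2" by (auto simp: eventually_sequentially)
  show thesis
  proof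
    fix n assume n: "n \<ge> Suc N"
    show "cylinder p n \<subseteq> V"
    proof
      fix y assume y: "y \<in> cylinder p n"
      have "z \<in> cylinder p n" using p by (simp add: codes_def)
      then have "dist z (act (prefix_word p n) 0) \<le> \<epsilon> n" "dist y (act (prefix_word p n) 0) \<le> \<epsilon> n"
        using \<epsilon>(2) y n by auto
      then have "dist z y < e" using N[of n] n dist_triangle2[of z y "act (prefix_word p n) 0"] by auto
      moreover have "y \<in> sphere 0 1" using y act_sphere by (auto simp: cylinder_def)
      ultimately show "y \<in> V" using e by auto
    qed
  qed
qed

lemma orbit_tendsto:
  assumes p: "reduced_seq p" "codes p z"
  shows "(\<lambda>n. act (prefix_word p n) 0) \<longlonglongrightarrow> z"
proof -
  obtain \<epsilon> where \<epsilon>: "\<epsilon> \<longlonglongrightarrow> 0" "\<And>n z. \<lbrakk>n > 0; z \<in> cylinder p n\<rbrakk> \<Longrightarrow> dist z (act (prefix_word p n) 0) \<le> \<epsilon> n"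
    using cylinder_near_orbit[OF p(1)] by blast
  have "(\<lambda>n. dist (act (prefix_word p n) 0) z) \<longlonglongrightarrow> 0"
  proof (rule tendsto_sandwich[OF _ _ tendsto_const \<epsilon>(1)])
    show "\<forall>\<^sub>F n in sequentially. dist (act (prefix_word p n) 0) z \<le> \<epsilon> n"
      using \<epsilon>(2) p by (intro eventually_mono[OF eventually_gt_at_top[of 0]]) (auto simp: codes_def dist_commute)
  qed simp
  then show ?thesis by (rule tendsto_dist_iff[THEN iffD2])
qed

section \<open>Concentration without control\<close>

lemma exists_third_letter: "\<exists>x :: letter. x \<noteq> a \<and> x \<noteq> b"
proof (cases "linv a = b")
  case True
  then have "(\<not> fst a, True) \<noteq> a \<and> (\<not> fst a, True) \<noteq> b" by (auto simp: linv_def prod_eq_iff)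
  then show ?thesis by blast
qed (metis linv_neq(1))

lemma connected_act_image:
  assumes "connected U" "U \<subseteq> sphere 0 1"
  shows "connected (act w ` U)"
proof (rule connected_continuous_image)
  show "continuous_on U (act w)"
    by (rule continuous_on_subset[OF continuous_act]) (use assms(2) in auto)
qed (rule assms)

text \<open>If \<open>s\<close> is not alternating, cut it at its first repeated letter, \<open>s = t @ [y, y] @ r\<close>, and undo
  \<open>u = t @ [y]\<close>. The image of \<open>U\<close> misses a point in the arc of \<open>y\<close>, since \<open>U\<close> misses a point in the arc
  of \<open>s\<close>, and it misses a point in the arc of \<open>linv y\<close>, the image of \<open>m\<close>. So it misses the whole arc of a letter
  \<open>w\<close> of the other generator, and \<open>u @ [w]\<close> is alternating.\<close>
lemma avoid_alternating_region:
  assumes U: "connected U" "U \<subseteq> sphere 0 1"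
    and s: "reduced s" "s \<noteq> []"
    and m: "m \<in> sphere 0 1" "m \<notin> E (hd s)" "m \<notin> U"
    and m': "m' \<in> C (last s)" "act (butlast s) m' \<notin> U"
    and disjoint: "U \<inter> act (butlast s) ` C (last s) = {}"
  obtains v where "alternating v" "v \<noteq> []" "hd v = hd s" "U \<inter> act (butlast v) ` C (last v) = {}"
proof -
  consider "alternating s" | t y r where "s = t @ [y, y] @ r" "alternating (t @ [y])"
    using alternating_prefix_cases[OF s] by blast
  then show thesis
  proof cases
    case 1
    then show thesis using that s disjoint by blast
  next
    case 2
    define u where "u = t @ [y]"
    have u: "reduced u" "u \<noteq> []" "hd u = hd s" "last u = y"
      using s 2 by (auto simp: u_def successively_append_iff hd_append)
    define U' where "U' = act (winv u) ` U"
    have unwind: "act u (act (winv u) z) = z" "act (winv u) (act u z) = z" if "z \<in> sphere 0 1" for z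
      using act_winv[of z u] act_winv'[of z u] that by simp_all
    have conn: "connected U'" unfolding U'_def using connected_act_image[OF U] .
    have sph: "U' \<subseteq> sphere 0 1" unfolding U'_def using act_sphere U(2) by blast
    have notin: "act (winv u) z \<notin> U'" if z: "z \<in> sphere 0 1" "z \<notin> U" for z
    proof
      assume "act (winv u) z \<in> U'"
      then obtain z' where z': "z' \<in> U" "act (winv u) z = act (winv u) z'" by (auto simp: U'_def)
      then have "z = z'" using unwind(1) z U(2) by (metis subsetD)
      then show False using z' z by simp
    qed
    define n' where "n' = act (butlast (y # r)) m'"
    have last_s: "last s = last (y # r)" "butlast s = u @ butlast (y # r)"
      using 2 by (auto simp: u_def butlast_append)
    have n'C: "n' \<in> C y"
    proof (cases "r = []")
      case True
      then show ?thesis using m' last_s by (simp add: n'_def)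
    next
      case False
      have "reduced (y # r)" using s 2 by (auto simp: successively_append_iff)
      then have "reduced (butlast (y # r) @ [last (y # r)])" by simp
      from ping_pong_word[OF this, of m'] False m' last_s have "n' \<in> E y"
        by (auto simp: n'_def)
      moreover have "n' \<in> sphere 0 1" unfolding n'_def using m' by (intro act_sphere) auto
      ultimately show ?thesis using E_subset by blast
    qed
    have "act u n' \<notin> U" using m'(2) last_s by (simp add: n'_def)
    then have n'U: "n' \<notin> U'"
      using notin[of "act u n'"] unwind(2)[of n'] n'C act_sphere[of n' u] by auto
    have mD: "act (winv u) m \<in> C (linv y)"
      using ping_pong_back[OF u(1,2), of m] m u act_sphere[of m "winv u"] by auto
    \<comment> \<open>Any letter of the other generator.\<close>
    define x where "x = (\<not> fst y, True)"
    have "U' \<inter> D x = {} \<or> U' \<inter> D (linv x) = {}"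
    proof (rule separation[OF conn sph n'C n'U mD])
      show "act (winv u) m \<notin> U'" using notin m by blast
    qed (simp add: x_def)
    then obtain w where w: "fst w \<noteq> fst y" "U' \<inter> D w = {}"
      by (metis fst_conv fst_linv x_def)
    show thesis
    proof (rule that[of "u @ [w]"])
      show "alternating (u @ [w])" using 2 w u by (simp add: u_def successively_append_iff)
      show "hd (u @ [w]) = hd s" using u by simp
      have "act u ` C w \<inter> U = {}"
      proof (rule ccontr)
        assume "act u ` C w \<inter> U \<noteq> {}"
        then obtain z where z: "z \<in> C w" "act u z \<in> U" by blast
        then have "z \<in> U'" unfolding U'_def using unwind(2)[of z] by (metis IntD2 imageI)
        then show False using w z by blast
      qed
      then show "U \<inter> act (butlast (u @ [w])) ` C (last (u @ [w])) = {}" by auto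
    qed simp
  qed
qed

text \<open>Let \<open>\<pi>\<close> be the shortest initial word whose cylinder lies in \<open>U\<close>, and \<open>U' = \<pi>\<inverse> U\<close>. Since \<open>U\<close> lies in
  the arc of the first letter of \<open>p\<close>, the set \<open>U'\<close> misses the arc of the reduced word \<open>s = \<pi>\<inverse>\<close>; by
  minimality of \<open>\<pi>\<close> it also misses a point outside the arc of the first letter of \<open>s\<close>. This yields an
  alternating word \<open>v\<close> whose arc is missed, and an occurrence of \<open>v\<inverse>\<close> in \<open>p\<close>, followed by the same letter
  as \<open>\<pi>\<close>, gives the element that concentrates \<open>U\<close>.\<close>
lemma concentrate:
  assumes p: "reduced_seq p" "codes p z"
    and freq: "\<And>v x M. \<lbrakk>alternating v; v \<noteq> []; x \<noteq> linv (last v)\<rbrakk> \<Longrightarrow> \<exists>N\<ge>M. occurs_at (v @ [x]) p N"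
    and U: "connected U" "U \<subseteq> E (p 0) \<inter> sphere 0 1" "openin (top_of_set (sphere 0 1)) U" "z \<in> U"
    and V: "openin (top_of_set (sphere 0 1)) V" "z \<in> V"
  obtains w where "z \<in> act w ` U" "act w ` U \<subseteq> V"
proof -
  obtain N0 where N0: "\<And>n. n \<ge> N0 \<Longrightarrow> cylinder p n \<subseteq> U"
    using cylinder_shrinks[OF p U(3,4)] by blast
  define n where "n = (LEAST n. cylinder p n \<subseteq> U)"
  have nU: "cylinder p n \<subseteq> U" unfolding n_def by (rule LeastI[of _ N0]) (use N0 in simp)
  \<comment> \<open>An end of the first arc: it keeps the arc itself from lying in \<open>U\<close>, so the least \<open>n\<close> is positive.\<close>
  obtain \<zeta>0 where \<zeta>0: "\<zeta>0 \<in> sphere 0 1" "\<zeta>0 \<in> D (p 0) - E (p 0)" using boundary by blast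
  have "\<not> cylinder p 0 \<subseteq> U" using U(2) \<zeta>0 by (auto simp: cylinder_def)
  then obtain k where k: "n = Suc k" using nU by (cases n) auto
  have "\<not> cylinder p k \<subseteq> U" using not_less_Least[of k "\<lambda>n. cylinder p n \<subseteq> U"] k unfolding n_def by simp
  then obtain c where c: "c \<in> C (p k)" "act (prefix_word p k) c \<notin> U"
    unfolding cylinder_def by blast
  define \<pi> where "\<pi> = prefix_word p n"
  define U' where "U' = act (winv \<pi>) ` U"
  define s where "s = winv \<pi>"
  have \<pi>: "reduced \<pi>" "\<pi> \<noteq> []" "hd \<pi> = p 0" "last \<pi> = p k" "butlast \<pi> = prefix_word p k"
    using reduced_prefix[OF p(1), of n] k hd_prefix[of n p] by (auto simp: \<pi>_def)
  have Usph: "U \<subseteq> sphere 0 1" using U by blast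
  have unwind: "act \<pi> (act (winv \<pi>) y) = y" "act (winv \<pi>) (act \<pi> y) = y" if "y \<in> sphere 0 1" for y
    using act_winv[of y \<pi>] act_winv'[of y \<pi>] that by simp_all
  have notin: "act (winv \<pi>) y \<notin> U'" if y: "y \<in> sphere 0 1" "y \<notin> U" for y
  proof
    assume "act (winv \<pi>) y \<in> U'"
    then obtain y' where y': "y' \<in> U" "act (winv \<pi>) y = act (winv \<pi>) y'" by (auto simp: U'_def)
    then have "y = y'" using unwind(1) y Usph by (metis subsetD)
    then show False using y' y by simp
  qed
  have s: "reduced s" "s \<noteq> []" "hd s = linv (p k)" "last s = linv (p 0)"
    using \<pi> by (auto simp: s_def hd_winv last_winv)
  have conn: "connected U'" unfolding U'_def using connected_act_image[OF U(1) Usph] .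
  have sph: "U' \<subseteq> sphere 0 1" unfolding U'_def using act_sphere Usph by blast
  have act_s: "act s y = act (butlast s) (f (linv (p 0)) y)" for y
  proof -
    have "s = butlast s @ [linv (p 0)]" using s by (metis append_butlast_last_id)
    then have "act s y = act (butlast s @ [linv (p 0)]) y" by simp
    then show ?thesis by simp
  qed
  \<comment> \<open>This point of the previous cylinder is missed by \<open>U\<close>, because \<open>n\<close> is least.\<close>
  define c' where "c' = act (prefix_word p k) c"
  have c'sph: "c' \<in> sphere 0 1" unfolding c'_def using c by (intro act_sphere) auto
  have act_c': "act s c' = f (linv (p k)) c"
    using act_winv[of c "prefix_word p k"] c by (simp add: s_def \<pi>_def k c'_def)
  obtain v where v: "alternating v" "v \<noteq> []" "hd v = hd s" "U' \<inter> act (butlast v) ` C (last v) = {}"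
  proof (rule avoid_alternating_region[OF conn sph s(1,2)])
    show "act s c' \<in> sphere 0 1" using c'sph by (rule act_sphere)
    show "act s c' \<notin> E (hd s)" using pairing_E[of c "linv (p k)"] c by (simp add: act_c' s)
    show "act s c' \<notin> U'" unfolding s_def using c'sph c by (intro notin) (auto simp: c'_def)
    have "f (linv (p 0)) \<zeta>0 \<in> D (linv (p 0))" using pairing[of \<zeta>0 "linv (p 0)"] \<zeta>0 by auto
    then show "f (linv (p 0)) \<zeta>0 \<in> C (last s)" using conformal_ball(3)[OF conf \<zeta>0(1)] s by auto
    have "act s \<zeta>0 \<notin> U'" unfolding s_def using \<zeta>0 U(2) by (intro notin) auto
    then show "act (butlast s) (f (linv (p 0)) \<zeta>0) \<notin> U'" by (simp add: act_s)
    show "U' \<inter> act (butlast s) ` C (last s) = {}"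
    proof (rule ccontr)
      assume "U' \<inter> act (butlast s) ` C (last s) \<noteq> {}"
      then obtain u y where u: "u \<in> U" "y \<in> C (linv (p 0))" "act s u = act (butlast s) y"
        unfolding U'_def s_def[symmetric] s(4) by blast
      have "f (linv (p 0)) u \<in> cball 0 1" "y \<in> cball 0 1"
        using f_cball[of u "linv (p 0)"] u(1,2) Usph by auto
      then have "f (linv (p 0)) u = y" using u(3) act_winv unfolding act_s by metis
      moreover have "u \<in> cball 0 1" "u \<in> E (p 0)" using u(1) U(2) by auto
      then have "f (linv (p 0)) u \<notin> D (linv (p 0))" using pairing[of u "linv (p 0)"] by simp
      ultimately show False using u(2) by blast
    qed
  qed
  obtain N1 where N1: "\<And>n. n \<ge> N1 \<Longrightarrow> cylinder p n \<subseteq> V"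
    using cylinder_shrinks[OF p V] by blast
  have "p n \<noteq> linv (last (winv v))"
    using v s p(1) k by (simp add: last_winv reduced_seq_def)
  then obtain N where N: "N \<ge> N1" "occurs_at (winv v @ [p n]) p N"
    using freq[of "winv v" "p n" N1] v(2) alternating_winv[of v] v(1) by (metis winv_simps(5))
  define l where "l = length v"
  have occ: "prefix_word (\<lambda>i. p (N + i)) l = winv v" "p (N + l) = p n" "p N = linv (last v)"
  proof -
    show "prefix_word (\<lambda>i. p (N + i)) l = winv v"
      using N(2) by (intro nth_equalityI) (auto simp: occurs_at_def l_def nth_append prefix_word_def)
    show "p (N + l) = p n" using N(2) by (auto simp: occurs_at_def l_def nth_append)
    have "l > 0" using v by (simp add: l_def)
    then have "p N = winv v ! 0" using N(2) by (auto simp: occurs_at_def l_def nth_append dest: spec[of _ 0])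
    then show "p N = linv (last v)" using v hd_winv[of v] by (simp add: hd_conv_nth)
  qed
  define w where "w = prefix_word p N @ winv v @ winv \<pi>"
  show thesis
  proof
    define y where "y = act (winv (prefix_word p (N + l))) z"
    have y: "y \<in> C (p n)" using codes_letter[OF p(2), of "N + l"] occ by (simp add: y_def)
    then have "act \<pi> y \<in> U" using nU by (auto simp: cylinder_def \<pi>_def)
    moreover have "act w (act \<pi> y) = z"
    proof -
      have "act w (act \<pi> y) = act (prefix_word p N) (act (winv v) y)" using unwind(2)[of y] y by (simp add: w_def)
      also have "\<dots> = act (prefix_word p (N + l)) y" by (simp add: prefix_add occ)
      also have "\<dots> = z" unfolding y_def using codes_sphere[OF p(2)] by (intro act_winv') simp
      finally show ?thesis .
    qed
    ultimately show "z \<in> act w ` U" by (metis imageI)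
    have "act w u \<in> cylinder p N" if u: "u \<in> U" for u
    proof -
      define u' where "u' = act (winv \<pi>) u"
      have u': "u' \<in> U'" using u by (simp add: U'_def u'_def)
      define t where "t = act (winv (butlast v)) u'"
      have tsph: "t \<in> sphere 0 1" unfolding t_def using u' sph by (intro act_sphere) auto
      have "act (butlast v) t = u'" unfolding t_def using u' sph by (intro act_winv') auto
      then have "t \<notin> D (last v)" using v(4) u' tsph by blast
      then have "f (linv (last v)) t \<in> E (linv (last v))" using pairing_E[of t "linv (last v)"] tsph by simp
      moreover have "f (linv (last v)) t = act (winv v) u'"
      proof -
        have "winv v = winv (butlast v @ [last v])" using v(2) by simp
        then show ?thesis by (simp add: t_def)
      qed
      ultimately have "act (winv v) u' \<in> C (p N)"
        using E_subset[of "linv (last v)"] occ(3) act_sphere[of u' "winv v"] u' sph by auto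
      then show ?thesis by (auto simp: cylinder_def w_def u'_def)
    qed
    then show "act w ` U \<subseteq> V" using N1[OF N(1)] by blast
  qed
qed

text \<open>With \<open>\<pi>\<close> and \<open>\<kappa>\<close> for the first \<open>n\<close> and the first \<open>k\<close> letters of \<open>p\<close>, let \<open>t\<close> be the reduced
  word of \<open>\<pi>\<inverse> w \<kappa>\<close>. If \<open>w\<close> maps \<open>U\<close> into \<open>V\<close>, then \<open>t\<close> maps the arc of \<open>p k\<close> into that of \<open>p n\<close>. This forbids
  that \<open>t\<close> ends with the inverse of \<open>p k\<close>, for then the image would be nearly the whole circle. Hence \<open>t\<close>
  can be followed by the letters of \<open>p\<close> from \<open>k\<close> on without cancellation, and when \<open>z\<close> lies in the image
  of \<open>V\<close> these letters occur in \<open>p\<close> a second time, at position \<open>n + length t\<close>.\<close>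
lemma not_concentrated_with_control:
  assumes p: "reduced_seq p" "codes p z"
    and nonrec: "\<And>k. \<exists>n\<ge>k. \<forall>j>n. \<exists>i\<le>n - k. p (j + i) \<noteq> p (k + i)"
    and U: "openin (top_of_set (sphere 0 1)) U" "z \<in> U"
  obtains V where "openin (top_of_set (sphere 0 1)) V" "z \<in> V"
    "\<And>w. z \<in> act w ` V \<Longrightarrow> \<not> act w ` U \<subseteq> V"
proof -
  obtain k where kU: "cylinder p k \<subseteq> U"
    using cylinder_shrinks[OF p U] by (metis order_refl)
  obtain n where n: "n \<ge> k" "\<And>j. j > n \<Longrightarrow> \<exists>i\<le>n - k. p (j + i) \<noteq> p (k + i)"
    using nonrec by blast
  define V where "V = act (prefix_word p n) ` (E (p n) \<inter> sphere 0 1)"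
  have unwind: "act v (act (winv v) y) = y" "act (winv v) (act v y) = y" if "y \<in> sphere 0 1" for y v
    using act_winv[of y v] act_winv'[of y v] that by simp_all
  have V_eq: "V = sphere 0 1 \<inter> act (winv (prefix_word p n)) -` E (p n)"
  proof
    show "V \<subseteq> sphere 0 1 \<inter> act (winv (prefix_word p n)) -` E (p n)"
      using unwind act_sphere unfolding V_def by auto
    show "sphere 0 1 \<inter> act (winv (prefix_word p n)) -` E (p n) \<subseteq> V"
    proof
      fix y assume y: "y \<in> sphere 0 1 \<inter> act (winv (prefix_word p n)) -` E (p n)"
      then have "act (winv (prefix_word p n)) y \<in> E (p n) \<inter> sphere 0 1" using act_sphere by blast
      then show "y \<in> V" unfolding V_def using unwind(1)[of y "prefix_word p n"] y by (metis IntD1 imageI)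
    qed
  qed
  have "z \<in> V" unfolding V_def using cylinder_Suc[OF p(1), of n] p(2) by (auto simp: codes_def)
  moreover have "openin (top_of_set (sphere 0 1)) V"
  proof -
    have "openin (top_of_set (sphere 0 1)) (sphere 0 1 \<inter> act (winv (prefix_word p n)) -` E (p n))"
    proof (rule continuous_openin_preimage[OF _ _ open_E])
      show "continuous_on (sphere 0 1) (act (winv (prefix_word p n)))"
        by (rule continuous_on_subset[OF continuous_act]) auto
      show "act (winv (prefix_word p n)) \<in> sphere 0 1 \<rightarrow> cball 0 1"
        using act_cball by auto
    qed
    then show ?thesis by (simp add: V_eq)
  qed
  moreover have "\<not> act w ` U \<subseteq> V" if zV: "z \<in> act w ` V" for w
  proof
    assume "act w ` U \<subseteq> V"
    obtain t where t: "reduced t" "\<And>y. y \<in> cball 0 1 \<Longrightarrow> act t y = act (winv (prefix_word p n) @ w @ prefix_word p k) y"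
      using reduced_representative by metis
    have tC: "act t y \<in> E (p n)" if y: "y \<in> C (p k)" for y
    proof -
      have "act (prefix_word p k) y \<in> U" using kU y by (auto simp: cylinder_def)
      then have "act w (act (prefix_word p k) y) \<in> V" using \<open>act w ` U \<subseteq> V\<close> by blast
      then show ?thesis using t(2)[of y] y by (simp add: V_eq)
    qed
    have tne: "t \<noteq> []"
    proof
      assume [simp]: "t = []"
      obtain \<zeta> where "\<zeta> \<in> sphere 0 1" "\<zeta> \<in> D (p k) - E (p k)" using boundary by blast
      moreover from this have "p k = p n" using tC[of \<zeta>] E_subset[of "p n"] disj[of "p k" "p n"] by auto
      ultimately show False using tC[of \<zeta>] by simp
    qed
    have last_t: "last t \<noteq> linv (p k)"
    proof
      assume last: "last t = linv (p k)"
      \<comment> \<open>The arc of \<open>x\<close> would be contained in the image, although it is disjoint from the arc of \<open>p n\<close>.\<close>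
      obtain x where x: "x \<noteq> hd t" "x \<noteq> p n" using exists_third_letter by blast
      obtain \<zeta> where \<zeta>: "\<zeta> \<in> C x" using C_nonempty by blast
      have "\<zeta> \<notin> E (hd t)" "\<zeta> \<notin> E (p n)" using \<zeta> x disj[of x "hd t"] disj[of x "p n"] E_subset by blast+
      then have "act (winv t) \<zeta> \<in> C (p k)"
        using ping_pong_back[OF t(1) tne, of \<zeta>] \<zeta> act_sphere[of \<zeta> "winv t"] last by auto
      from tC[OF this] show False using unwind(1)[of \<zeta> t] \<zeta> \<open>\<zeta> \<notin> E (p n)\<close> by simp
    qed
    have red: "reduced (t @ prefix_word (\<lambda>i. p (k + i)) m)" for m
      using t(1) tne last_t reduced_prefix[OF reduced_seq_shift[OF p(1)], of k m]
        hd_prefix[of m "\<lambda>i. p (k + i)"]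
      by (cases "m = 0") (auto simp: successively_append_iff linv_def prod_eq_iff simp del: prefix_word_simps(3))
    define u where "u = t @ prefix_word (\<lambda>i. p (k + i)) (n - k)"
    obtain v where v: "v \<in> V" "z = act w v" using zV by blast
    obtain y where y: "y \<in> E (p n) \<inter> sphere 0 1" "v = act (prefix_word p n) y" using v(1) by (auto simp: V_def)
    have yC: "y \<in> C (p n)" using y E_subset by blast
    have split: "prefix_word p n = prefix_word p k @ prefix_word (\<lambda>i. p (k + i)) (n - k)"
      using prefix_add[of p k "n - k"] n(1) by simp
    have "act (winv (prefix_word p n)) z = act u y"
      using t(2)[of "act (prefix_word (\<lambda>i. p (k + i)) (n - k)) y"] yC
      by (simp add: v y(2) u_def) (simp add: split)
    moreover have "reduced (u @ [p n])"
      using red[of "Suc (n - k)"] n(1) by (simp add: u_def)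
    ultimately have "occurs_at (u @ [p n]) (\<lambda>i. p (n + i)) 0"
      using codes_word[OF codes_shift[OF p(2)] reduced_seq_shift[OF p(1)] _ _ yC] by blast
    then have occ: "p (n + i) = (t @ prefix_word (\<lambda>i. p (k + i)) (Suc (n - k))) ! i" if "i < length t + Suc (n - k)" for i
      using that n(1) by (auto simp: occurs_at_def u_def)
    have "n + length t > n" using tne by simp
    from n(2)[OF this] obtain i where i: "i \<le> n - k" "p (n + length t + i) \<noteq> p (k + i)" by blast
    have "p (n + length t + i) = prefix_word (\<lambda>i. p (k + i)) (Suc (n - k)) ! i"
      using occ[of "length t + i"] i(1) by (simp add: add.assoc nth_append del: prefix_word_simps(3))
    also have "\<dots> = p (k + i)" using i(1) by (simp add: prefix_word_def del: upt_Suc)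
    finally show False using i(2) by simp
  qed
  ultimately show thesis using that by blast
qed

lemma coded_point_classification:
  assumes \<Gamma>: "\<And>\<gamma>. \<gamma> \<in> \<Gamma> \<Longrightarrow> \<exists>w. \<forall>z\<in>cball 0 1. \<gamma> z = act w z"
      "\<And>w. \<exists>\<gamma>\<in>\<Gamma>. \<forall>z\<in>cball 0 1. \<gamma> z = act w z"
    and p: "reduced_seq p" "codes p z"
    and freq: "\<And>v x M. \<lbrakk>alternating v; v \<noteq> []; x \<noteq> linv (last v)\<rbrakk> \<Longrightarrow> \<exists>N\<ge>M. occurs_at (v @ [x]) p N"
    and nonrec: "\<And>k. \<exists>n\<ge>k. \<forall>j>n. \<exists>i\<le>n - k. p (j + i) \<noteq> p (k + i)"
  shows "limit_point \<Gamma> z" "concentration_point \<Gamma> z" "\<not> controlled_concentration_point \<Gamma> z"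
proof -
  have zsph: "z \<in> sphere 0 1" using codes_sphere[OF p(2)] .
  have image: "\<gamma> ` A = act w ` A" if "\<forall>z\<in>cball 0 1. \<gamma> z = act w z" "A \<subseteq> sphere 0 1" for \<gamma> w A
    using that by (intro image_cong) auto
  show lim: "limit_point \<Gamma> z"
    unfolding limit_point_def
  proof (intro conjI bexI[of _ 0])
    show "z islimpt (\<lambda>\<gamma>. \<gamma> 0) ` \<Gamma>"
      unfolding islimpt_sequential
    proof (intro exI[of _ "\<lambda>n. act (prefix_word p n) 0"] conjI allI)
      fix n
      obtain \<gamma> where "\<gamma> \<in> \<Gamma>" "\<gamma> 0 = act (prefix_word p n) 0" using \<Gamma>(2)[of "prefix_word p n"] by auto
      then have "act (prefix_word p n) 0 \<in> (\<lambda>\<gamma>. \<gamma> 0) ` \<Gamma>" by (metis imageI)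
      moreover have "act (prefix_word p n) 0 \<noteq> z" using act_ball[of 0 "prefix_word p n"] zsph by auto
      ultimately show "act (prefix_word p n) 0 \<in> (\<lambda>\<gamma>. \<gamma> 0) ` \<Gamma> - {z}" by simp
    qed (rule orbit_tendsto[OF p])
  qed (use zsph in auto)
  have W: "circle_nbhd z (E (p 0) \<inter> sphere 0 1)"
    unfolding circle_nbhd_def
  proof
    have "openin (top_of_set (sphere 0 1)) (sphere 0 1 \<inter> E (p 0))"
      using open_E[of "p 0"] by (auto simp: openin_open)
    then show "openin (top_of_set (sphere 0 1)) (E (p 0) \<inter> sphere 0 1)" by (simp add: Int_commute)
    show "z \<in> E (p 0) \<inter> sphere 0 1" using cylinder_Suc[OF p(1), of 0] p(2) by (auto simp: codes_def)
  qed
  have "can_be_concentrated \<Gamma> U z" if U: "circle_nbhd z U" "connected U" "U \<subseteq> E (p 0) \<inter> sphere 0 1" for U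
    unfolding can_be_concentrated_def
  proof (intro allI impI)
    fix V assume V: "circle_nbhd z V"
    obtain w where w: "z \<in> act w ` U" "act w ` U \<subseteq> V"
      using concentrate[OF p freq U(2,3)] U(1) V unfolding circle_nbhd_def by metis
    obtain \<gamma> where \<gamma>: "\<gamma> \<in> \<Gamma>" "\<forall>z\<in>cball 0 1. \<gamma> z = act w z" using \<Gamma>(2) by blast
    have "\<gamma> ` U = act w ` U" using \<gamma>(2) U(3) by (intro image) auto
    then show "\<exists>\<gamma>\<in>\<Gamma>. z \<in> \<gamma> ` U \<and> \<gamma> ` U \<subseteq> V" using \<gamma>(1) w by metis
  qed
  then show "concentration_point \<Gamma> z"
    unfolding concentration_point_def using lim W by blast
  have "\<not> can_be_concentrated_with_control \<Gamma> U z" if U: "circle_nbhd z U" for U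
  proof
    assume ctrl: "can_be_concentrated_with_control \<Gamma> U z"
    obtain V where V: "openin (top_of_set (sphere 0 1)) V" "z \<in> V" "\<And>w. z \<in> act w ` V \<Longrightarrow> \<not> act w ` U \<subseteq> V"
      using not_concentrated_with_control[OF p nonrec] U unfolding circle_nbhd_def by metis
    then obtain \<gamma> where \<gamma>: "\<gamma> \<in> \<Gamma>" "\<gamma> ` U \<subseteq> V" "z \<in> \<gamma> ` V"
      using ctrl unfolding can_be_concentrated_with_control_def circle_nbhd_def by blast
    obtain w where w: "\<forall>z\<in>cball 0 1. \<gamma> z = act w z" using \<Gamma>(1) \<gamma>(1) by blast
    have "U \<subseteq> sphere 0 1" "V \<subseteq> sphere 0 1"
      using U V(1) openin_imp_subset unfolding circle_nbhd_def by blast+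
    then show False using V(3)[of w] \<gamma> image[OF w] by metis
  qed
  then show "\<not> controlled_concentration_point \<Gamma> z"
    unfolding controlled_concentration_point_def by blast
qed

end

section \<open>Hyperbolic translations and half-discs\<close>

text \<open>The translation along the diameter through \<open>w\<close> that carries \<open>w\<close> to the origin.\<close>
abbreviation translation :: "complex \<Rightarrow> complex \<Rightarrow> complex" where
  "translation w \<equiv> Moebius_function 0 w"

lemma translation_denominator_nonzero:
  assumes "norm w < 1" "norm z \<le> 1"
  shows "1 - cnj w * z \<noteq> 0"
proof
  assume "1 - cnj w * z = 0"
  then have "1 = norm w * norm z" by (metis complex_mod_cnj eq_iff_diff_eq_0 norm_mult norm_one)
  also have "\<dots> \<le> norm w * 1" using assms by (intro mult_left_mono) auto
  finally show False using assms by simp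
qed

lemma translation_inverse:
  assumes "norm w < 1" "norm z \<le> 1"
  shows "translation (- w) (translation w z) = z"
proof -
  define e where "e = 1 - cnj w * z"
  have e: "e \<noteq> 0" using translation_denominator_nonzero[OF assms] by (simp add: e_def)
  have w: "1 - cnj w * w \<noteq> 0" using translation_denominator_nonzero[of w w] assms by simp
  have "translation (- w) (translation w z) = ((z - w) / e + w) / (1 + cnj w * ((z - w) / e))"
    by (simp add: Moebius_function_simple e_def)
  also have "\<dots> = ((z - w) + w * e) / (e + cnj w * (z - w))"
    using e by (simp add: add_divide_distrib[symmetric] divide_simps)
  also have "\<dots> = (z * (1 - cnj w * w)) / (1 - cnj w * w)" by (simp add: e_def algebra_simps)
  finally show ?thesis using w by simp
qed

lemma conformal_translation:
  assumes "norm w < 1"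
  shows "conformal (translation w)"
  unfolding conformal_def
proof (intro exI[of _ "\<lambda>z. (1 - (norm w)\<^sup>2) / (norm (1 - cnj w * z))\<^sup>2"] ballI conjI)
  have w: "1 - (norm w)\<^sup>2 > 0" using assms by (simp add: abs_square_less_1)
  fix z :: complex assume "z \<in> cball 0 1"
  then have e: "1 - cnj w * z \<noteq> 0" using translation_denominator_nonzero[OF assms] by simp
  show "0 < (1 - (norm w)\<^sup>2) / (norm (1 - cnj w * z))\<^sup>2" using e w by simp
  have "(norm (1 - cnj w * z))\<^sup>2 - (norm (z - w))\<^sup>2 = (1 - (norm w)\<^sup>2) * (1 - (norm z)\<^sup>2)"
    unfolding cmod_power2 by (simp add: algebra_simps power2_eq_square)
  then show "1 - (norm (translation w z))\<^sup>2 = (1 - (norm w)\<^sup>2) / (norm (1 - cnj w * z))\<^sup>2 * (1 - (norm z)\<^sup>2)"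
    using e by (simp add: Moebius_function_simple norm_divide power_divide field_simps)
  fix y :: complex assume "y \<in> cball 0 1"
  then have e': "1 - cnj w * y \<noteq> 0" using translation_denominator_nonzero[OF assms] by simp
  have "translation w z - translation w y = (z - y) * (1 - cnj w * w) / ((1 - cnj w * z) * (1 - cnj w * y))"
    using e e' by (simp add: Moebius_function_simple diff_frac_eq) (simp add: algebra_simps)
  also have "1 - cnj w * w = of_real (1 - (norm w)\<^sup>2)"
    using complex_norm_square[of w] by (simp add: mult.commute)
  finally have "dist (translation w z) (translation w y)
     = dist z y * (1 - (norm w)\<^sup>2) / (norm (1 - cnj w * z) * norm (1 - cnj w * y))"
    using w by (simp only: dist_norm norm_mult norm_divide norm_of_real)
  then show "(dist (translation w z) (translation w y))\<^sup>2 = (1 - (norm w)\<^sup>2) / (norm (1 - cnj w * z))\<^sup>2 *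
     ((1 - (norm w)\<^sup>2) / (norm (1 - cnj w * y))\<^sup>2) * (dist z y)\<^sup>2"
    by (simp add: power_mult_distrib power_divide power2_eq_square ac_simps)
qed

lemma continuous_translation: "norm w < 1 \<Longrightarrow> continuous_on (cball 0 1) (translation w)"
  unfolding Moebius_function_simple[abs_def]
  by (intro continuous_intros) (use translation_denominator_nonzero in auto)

text \<open>The power of \<open>z\<close> with respect to the circle with centre \<open>c\<close> orthogonal to the unit circle; it is
  negative inside that circle.\<close>
definition side :: "complex \<Rightarrow> complex \<Rightarrow> real" where
  "side c z = (norm z)\<^sup>2 + 1 - 2 * Re (cnj c * z)"

definition half_disc :: "complex \<Rightarrow> complex set" where
  "half_disc c = {z \<in> cball 0 1. side c z \<le> 0}"

definition open_half_disc :: "complex \<Rightarrow> complex set" where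
  "open_half_disc c = {z \<in> cball 0 1. side c z < 0}"

lemma circle_geodesic_side:
  assumes "circle_geodesic c A"
  shows "norm c > 1" "A = {z \<in> ball 0 1. side c z = 0}"
proof -
  obtain r where r: "r > 0" "(norm c)\<^sup>2 = 1 + r\<^sup>2" "A = ball 0 1 \<inter> sphere c r"
    using assms unfolding circle_geodesic_def by blast
  have "1\<^sup>2 < (norm c)\<^sup>2" using r by simp
  then show "norm c > 1" by (rule power2_less_imp_less) simp
  have "z \<in> sphere c r \<longleftrightarrow> side c z = 0" for z
  proof -
    have "z \<in> sphere c r \<longleftrightarrow> (dist c z)\<^sup>2 = r\<^sup>2" using r(1) by (simp add: power2_eq_iff_nonneg)
    moreover have "(dist c z)\<^sup>2 = (norm z)\<^sup>2 + (norm c)\<^sup>2 - 2 * Re (cnj c * z)"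
      unfolding dist_norm cmod_power2 by (simp add: algebra_simps power2_eq_square)
    ultimately show ?thesis using r(2) by (auto simp: side_def)
  qed
  then show "A = {z \<in> ball 0 1. side c z = 0}" using r(3) by blast
qed

text \<open>The points \<open>\<zeta> * (1 + v \<epsilon>)\<close> are a rational parametrisation of the part of the geodesic near its end
  \<open>\<zeta>\<close>, where \<open>c = \<zeta> * (1 + \<i> \<eta>)\<close>.\<close>
lemma geodesic_end_in_closure:
  assumes A: "circle_geodesic c A" and \<zeta>: "norm \<zeta> = 1" "side c \<zeta> = 0"
  shows "\<zeta> \<in> closure A"
proof -
  define \<eta> where "\<eta> = Im (c * cnj \<zeta>)"
  have re: "Re (c * cnj \<zeta>) = 1" using \<zeta> by (simp add: side_def mult.commute)
  then have c_eq: "c = \<zeta> * Complex 1 \<eta>"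
  proof -
    have "c * cnj \<zeta> = Complex 1 \<eta>" using re by (simp add: \<eta>_def complex_eq_iff)
    moreover have "cnj \<zeta> * \<zeta> = 1" using \<zeta>(1) by (metis complex_norm_square mult.commute of_real_1 one_power2)
    ultimately show ?thesis by (metis mult.assoc mult.commute mult.right_neutral)
  qed
  have "norm c = norm (Complex 1 \<eta>)" using \<zeta> by (simp add: c_eq norm_mult)
  then have "1 < 1 + \<eta>\<^sup>2" using circle_geodesic_side(1)[OF A] by (simp add: complex_norm)
  then have \<eta>: "\<eta> \<noteq> 0" by auto
  define v where "v \<epsilon> = Complex (- 2 * \<epsilon> * \<eta>\<^sup>2 / (\<eta>\<^sup>2 + \<epsilon>\<^sup>2)) (2 * \<epsilon>\<^sup>2 * \<eta> / (\<eta>\<^sup>2 + \<epsilon>\<^sup>2))" for \<epsilon>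
  have inA: "\<zeta> * (1 + v \<epsilon>) \<in> A" if \<epsilon>: "0 < \<epsilon>" "\<epsilon> < 1" for \<epsilon>
  proof -
    define d where "d = \<eta>\<^sup>2 + \<epsilon>\<^sup>2"
    have d: "d > 0" using \<eta> by (simp add: d_def add_pos_nonneg)
    have rv: "Re (v \<epsilon>) = - 2 * \<epsilon> * \<eta>\<^sup>2 / d" "Im (v \<epsilon>) = 2 * \<epsilon>\<^sup>2 * \<eta> / d" by (auto simp: v_def d_def)
    have sq: "(norm (v \<epsilon>))\<^sup>2 = 4 * \<epsilon>\<^sup>2 * \<eta>\<^sup>2 / d"
    proof -
      have "(norm (v \<epsilon>))\<^sup>2 = ((- 2 * \<epsilon> * \<eta>\<^sup>2)\<^sup>2 + (2 * \<epsilon>\<^sup>2 * \<eta>)\<^sup>2) / d\<^sup>2"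
        unfolding cmod_power2 rv power_divide add_divide_distrib ..
      also have "(- 2 * \<epsilon> * \<eta>\<^sup>2)\<^sup>2 + (2 * \<epsilon>\<^sup>2 * \<eta>)\<^sup>2 = 4 * \<epsilon>\<^sup>2 * \<eta>\<^sup>2 * d"
        by (simp add: d_def algebra_simps power2_eq_square)
      finally have "(norm (v \<epsilon>))\<^sup>2 = 4 * \<epsilon>\<^sup>2 * \<eta>\<^sup>2 * d / d\<^sup>2" .
      then show ?thesis using d by (simp add: power2_eq_square)
    qed
    have n: "(norm (\<zeta> * (1 + v \<epsilon>)))\<^sup>2 = 1 + 2 * Re (v \<epsilon>) + (norm (v \<epsilon>))\<^sup>2"
    proof -
      have eq: "norm (\<zeta> * (1 + v \<epsilon>)) = norm (1 + v \<epsilon>)" using \<zeta> by (simp add: norm_mult)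
      show ?thesis unfolding eq cmod_power2
        by (simp add: power2_eq_square algebra_simps)
    qed
    also have "\<dots> = 1 - 4 * \<epsilon> * (1 - \<epsilon>) * \<eta>\<^sup>2 / d"
      unfolding sq rv using d by (simp add: field_simps power2_eq_square)
    also have "\<dots> < 1" using \<epsilon> \<eta> d by simp
    finally have "norm (\<zeta> * (1 + v \<epsilon>)) < 1" by (simp add: abs_square_less_1)
    moreover have "side c (\<zeta> * (1 + v \<epsilon>)) = 0"
    proof -
      have "cnj c * (\<zeta> * (1 + v \<epsilon>)) = (\<zeta> * cnj \<zeta>) * (Complex 1 (-\<eta>) * (1 + v \<epsilon>))"
        by (simp add: c_eq complex_cnj ac_simps)
      also have "\<zeta> * cnj \<zeta> = 1" using \<zeta> by (metis complex_norm_square of_real_1 one_power2)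
      finally have eq: "cnj c * (\<zeta> * (1 + v \<epsilon>)) = Complex 1 (-\<eta>) * (1 + v \<epsilon>)" by (simp only: mult_1_left)
      have "Re (cnj c * (\<zeta> * (1 + v \<epsilon>))) = 1 + Re (v \<epsilon>) + \<eta> * Im (v \<epsilon>)" unfolding eq by simp
      moreover have "2 * (\<eta> * Im (v \<epsilon>)) = (norm (v \<epsilon>))\<^sup>2" unfolding sq rv by (simp add: power2_eq_square)
      ultimately show ?thesis unfolding side_def n by simp
    qed
    ultimately show ?thesis using circle_geodesic_side(2)[OF A] by simp
  qed
  define e where "e n = 1 / (real n + 2)" for n
  have e: "e \<longlonglongrightarrow> 0" unfolding e_def by real_asymp
  have "(\<lambda>n. \<zeta> * (1 + v (e n))) \<longlonglongrightarrow> \<zeta> * (1 + v 0)"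
    unfolding v_def by (intro tendsto_intros e) (use \<eta> in auto)
  moreover have "v 0 = 0" by (simp add: v_def complex_eq_iff)
  moreover have "\<zeta> * (1 + v (e n)) \<in> A" for n by (rule inA) (auto simp: e_def)
  ultimately show ?thesis
    unfolding closure_sequential by (intro exI[of _ "\<lambda>n. \<zeta> * (1 + v (e n))"]) simp
qed

text \<open>Otherwise the two circles meet in the closed disc, on the line through the origin and
  \<open>(1 / s, 1 / t)\<close>; the factor \<open>m\<close> solves the quadratic equation for the smaller intersection point.\<close>
lemma perpendicular_geodesics_disjoint:
  assumes a: "circle_geodesic (of_real s) a" and b: "circle_geodesic (\<i> * of_real t) b"
    and dis: "disjnt (closure a) (closure b)"
  shows "1 / s\<^sup>2 + 1 / t\<^sup>2 > 1"
proof (rule ccontr)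
  assume "\<not> ?thesis"
  then have q: "1 / s\<^sup>2 + 1 / t\<^sup>2 \<le> 1" by simp
  have nz: "s \<noteq> 0" "t \<noteq> 0"
    using circle_geodesic_side(1)[OF a] circle_geodesic_side(1)[OF b] by (auto simp: norm_mult)
  define c where "c = sqrt (1 - (1 / s\<^sup>2 + 1 / t\<^sup>2))"
  have c: "c \<ge> 0" "c\<^sup>2 = 1 - (1 / s\<^sup>2 + 1 / t\<^sup>2)" using q by (auto simp: c_def)
  define m where "m = 1 / (1 + c)"
  define z where "z = Complex (m / s) (m / t)"
  have "(norm z)\<^sup>2 = m\<^sup>2 * (1 - c\<^sup>2)"
    unfolding cmod_power2 c(2) by (simp add: z_def field_simps power_divide)
  also have "\<dots> = 2 * m - 1"
  proof -
    have "m * c = 1 - m" using c(1) by (simp add: m_def field_simps)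
    moreover have "m\<^sup>2 * (1 - c\<^sup>2) = m\<^sup>2 - (m * c)\<^sup>2" by (simp add: algebra_simps power_mult_distrib)
    ultimately show ?thesis by (simp add: power2_diff)
  qed
  finally have n: "(norm z)\<^sup>2 = 2 * m - 1" .
  have side: "side (of_real s) z = 0" "side (\<i> * of_real t) z = 0"
    using nz unfolding side_def n by (auto simp: z_def)
  have "z \<in> closure a \<inter> closure b"
  proof (cases "c = 0")
    case True
    then have "(norm z)\<^sup>2 = 1" using n by (simp add: m_def)
    then have "norm z = 1" by (simp add: abs_square_eq_1)
    then show ?thesis using geodesic_end_in_closure a b side by blast
  next
    case False
    then have "m < 1" using c by (simp add: m_def)
    then have "(norm z)\<^sup>2 < 1" using n by simp
    then have "norm z < 1" by (simp add: abs_square_less_1)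
    then have "z \<in> a \<inter> b" using side circle_geodesic_side(2)[OF a] circle_geodesic_side(2)[OF b] by simp
    then show ?thesis using closure_subset by blast
  qed
  then show False using dis by (auto simp: disjnt_def)
qed

lemma perpendicular_half_discs_disjoint:
  assumes "1 / s\<^sup>2 + 1 / t\<^sup>2 > 1" and nz: "s \<noteq> 0" "t \<noteq> 0"
  shows "half_disc (of_real s) \<inter> half_disc (\<i> * of_real t) = {}"
proof (rule ccontr)
  assume "\<not> ?thesis"
  then obtain z where z: "side (of_real s) z \<le> 0" "side (\<i> * of_real t) z \<le> 0"
    by (auto simp: half_disc_def)
  define P where "P = ((norm z)\<^sup>2 + 1) / 2"
  have P: "P > 0" unfolding P_def by (simp add: add_nonneg_pos)
  have "P \<le> s * Re z" "P \<le> t * Im z" using z by (auto simp: side_def P_def)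
  then have "P\<^sup>2 \<le> (s * Re z)\<^sup>2" "P\<^sup>2 \<le> (t * Im z)\<^sup>2" using P by (auto intro!: power_mono)
  then have "P\<^sup>2 / s\<^sup>2 \<le> (Re z)\<^sup>2" "P\<^sup>2 / t\<^sup>2 \<le> (Im z)\<^sup>2"
    using nz by (auto simp: field_simps power_mult_distrib)
  then have "P\<^sup>2 * (1 / s\<^sup>2 + 1 / t\<^sup>2) \<le> (norm z)\<^sup>2"
    unfolding cmod_power2 by (simp add: algebra_simps)
  moreover have "P\<^sup>2 * 1 < P\<^sup>2 * (1 / s\<^sup>2 + 1 / t\<^sup>2)" using assms(1) P by (intro mult_strict_left_mono) auto
  moreover have "(norm z)\<^sup>2 \<le> P\<^sup>2"
  proof -
    have "P\<^sup>2 - (norm z)\<^sup>2 = (((norm z)\<^sup>2 - 1) / 2)\<^sup>2" by (simp add: P_def field_simps power2_eq_square)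
    then show ?thesis by (metis diff_ge_0_iff_ge zero_le_power2)
  qed
  ultimately show False by simp
qed

lemma opposite_half_discs_disjoint:
  assumes "s * s' < 0"
  shows "half_disc (of_real s * u) \<inter> half_disc (of_real s' * u) = {}"
proof (rule ccontr)
  assume "\<not> ?thesis"
  then obtain z where z: "side (of_real s * u) z \<le> 0" "side (of_real s' * u) z \<le> 0"
    by (auto simp: half_disc_def)
  define x where "x = Re (cnj u * z)"
  have x: "Re (cnj (of_real r * u) * z) = r * x" for r by (simp add: x_def algebra_simps)
  have "0 < s * x" "0 < s' * x" using z x[of s] x[of s'] zero_le_power2[of "norm z"] unfolding side_def by linarith+
  then have "0 < (s * s') * x\<^sup>2" by (metis mult_pos_pos mult.assoc mult.left_commute power2_eq_square)
  then show False using assms by (auto simp: zero_less_mult_iff mult_less_0_iff)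
qed

text \<open>A translation along the diameter through \<open>u\<close> permutes the circles that are centred on the line of
  \<open>u\<close> and orthogonal to the unit circle; this is the formula for the pencil they span.\<close>
lemma side_translation:
  fixes k s :: real
  assumes u: "norm u = 1" and k: "\<bar>k\<bar> < 1" and z: "norm z \<le> 1"
  shows "side (of_real s * u) (translation (of_real k * u) z) * (norm (1 - cnj (of_real k * u) * z))\<^sup>2
       = (1 + k\<^sup>2 + 2 * s * k) * ((norm z)\<^sup>2 + 1) - 2 * (2 * k + s * (1 + k\<^sup>2)) * Re (cnj u * z)"
proof -
  define x where "x = cnj u * z"
  have uu: "cnj u * u = 1" using u by (metis complex_norm_square mult.commute of_real_1 one_power2)
  have z_eq: "z = u * x" using uu by (simp add: x_def mult.assoc[symmetric] mult.commute)
  have nz: "norm z = norm x" using u by (simp add: z_eq norm_mult)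
  define e where "e = 1 - of_real k * x"
  have e_eq: "1 - cnj (of_real k * u) * z = e" by (simp add: e_def x_def mult.assoc)
  have w: "norm (of_real k * u) < 1" using u k by (simp add: norm_mult)
  have e: "e \<noteq> 0" using translation_denominator_nonzero[OF w z] unfolding e_eq .
  have m: "translation (of_real k * u) z = u * ((x - of_real k) / e)"
    unfolding Moebius_function_simple e_eq by (simp add: z_eq algebra_simps)
  have c: "cnj (of_real s * u) * (u * ((x - of_real k) / e)) = of_real s * ((x - of_real k) / e)"
    using uu by (metis complex_cnj_complex_of_real complex_cnj_mult mult.assoc mult.right_neutral mult.commute)
  have nrm: "(norm (u * ((x - of_real k) / e)))\<^sup>2 = (norm (x - of_real k))\<^sup>2 / (norm e)\<^sup>2"
    using u by (simp add: norm_mult norm_divide power_divide)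
  have "(x - of_real k) / e = of_real (1 / (norm e)\<^sup>2) * ((x - of_real k) * cnj e)"
    using complex_div_cnj[of "x - of_real k" e] by simp
  moreover have "Re (of_real s * (of_real r * y)) = s * (r * Re y)" for r y by simp
  ultimately have re: "Re (of_real s * ((x - of_real k) / e)) = s * (1 / (norm e)\<^sup>2 * Re ((x - of_real k) * cnj e))"
    by (simp only:)
  have "side (of_real s * u) (translation (of_real k * u) z) * (norm e)\<^sup>2
     = ((norm (x - of_real k))\<^sup>2 / (norm e)\<^sup>2 + 1 - 2 * (s * (1 / (norm e)\<^sup>2 * Re ((x - of_real k) * cnj e)))) * (norm e)\<^sup>2"
    unfolding side_def m c nrm re ..
  also have "\<dots> = (norm (x - of_real k))\<^sup>2 + (norm e)\<^sup>2 - 2 * s * Re ((x - of_real k) * cnj e)"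
    using e by (simp add: field_simps)
  also have "\<dots> = (1 + k\<^sup>2 + 2 * s * k) * ((norm x)\<^sup>2 + 1) - 2 * (2 * k + s * (1 + k\<^sup>2)) * Re x"
    unfolding cmod_power2 e_def by (simp add: algebra_simps power2_eq_square)
  finally show ?thesis by (simp only: e_eq nz x_def[symmetric])
qed

lemma geodesic_meets_axis:
  fixes s :: real
  assumes "\<bar>s\<bar> > 1"
  obtains r where "\<bar>r\<bar> < 1" "r \<noteq> 0" "r\<^sup>2 + 1 = 2 * s * r"
proof -
  define q where "q = sqrt (s\<^sup>2 - 1)"
  have s2: "s\<^sup>2 > 1" using one_less_power[of "\<bar>s\<bar>" 2] assms by simp
  have q: "q > 0" "q\<^sup>2 = s\<^sup>2 - 1" using s2 by (auto simp: q_def)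
  define r where "r = (if s > 0 then s - q else s + q)"
  have eq: "r\<^sup>2 + 1 = 2 * s * r" using q by (auto simp: r_def power2_eq_square algebra_simps)
  have "r \<noteq> 0" using eq by auto
  have q_less: "q < \<bar>s\<bar>" by (rule power2_less_imp_less) (use q s2 in auto)
  have "\<bar>s\<bar> - 1 < q"
  proof (rule power2_less_imp_less)
    show "(\<bar>s\<bar> - 1)\<^sup>2 < q\<^sup>2" using assms unfolding q(2) by (simp add: power2_diff)
  qed (use q in simp)
  then have "\<bar>r\<bar> < 1" using q_less by (auto simp: r_def)
  then show thesis using that eq \<open>r \<noteq> 0\<close> by blast
qed

text \<open>In the pencil formula, the point where the geodesic with parameter \<open>s'\<close> meets the axis shows that the
  side function of \<open>s * u\<close> pulls back to a multiple \<open>A\<close> of that of \<open>s' * u\<close>, up to a positive factor. As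
  the two centres lie on different sides of the origin, \<open>A\<close> is negative, so the inside of one geodesic
  is carried to the outside of the other.\<close>
lemma translation_pairs_half_discs:
  fixes k s s' :: real
  assumes u: "norm u = 1" and k: "\<bar>k\<bar> < 1" and s: "\<bar>s\<bar> > 1" "\<bar>s'\<bar> > 1" "s * s' < 0"
    and img: "translation (of_real k * u) ` {z \<in> ball 0 1. side (of_real s' * u) z = 0}
      = {z \<in> ball 0 1. side (of_real s * u) z = 0}"
    and z: "z \<in> cball 0 1"
  shows "translation (of_real k * u) z \<in> half_disc (of_real s * u) \<longleftrightarrow> z \<notin> open_half_disc (of_real s' * u)"
    "translation (of_real k * u) z \<in> open_half_disc (of_real s * u) \<longleftrightarrow> z \<notin> half_disc (of_real s' * u)"
proof -
  define A where "A = 1 + k\<^sup>2 + 2 * s * k"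
  define B where "B = 2 * k + s * (1 + k\<^sup>2)"
  define N where "N y = (norm (1 - cnj (of_real k * u) * y))\<^sup>2" for y
  have formula: "side (of_real s * u) (translation (of_real k * u) y) * N y = A * ((norm y)\<^sup>2 + 1) - 2 * B * Re (cnj u * y)"
    if "norm y \<le> 1" for y
    using side_translation[OF u k that, of s] by (simp add: A_def B_def N_def)
  have uu: "cnj u * u = 1" using u by (metis complex_norm_square mult.commute of_real_1 one_power2)
  have side_u: "side (of_real r * u) y = (norm y)\<^sup>2 + 1 - 2 * r * Re (cnj u * y)" for r y
    by (simp add: side_def algebra_simps)
  obtain r where r: "\<bar>r\<bar> < 1" "r \<noteq> 0" "r\<^sup>2 + 1 = 2 * s' * r" using geodesic_meets_axis[OF s(2)] .
  define y where "y = of_real r * u"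
  have y: "norm y = \<bar>r\<bar>" "Re (cnj u * y) = r"
  proof -
    show "norm y = \<bar>r\<bar>" using u by (simp add: y_def norm_mult)
    have "cnj u * y = of_real r * (cnj u * u)" by (simp add: y_def)
    then show "Re (cnj u * y) = r" by (simp only: uu) simp
  qed
  have "side (of_real s' * u) y = 0" unfolding side_u y using r by simp
  then have "side (of_real s * u) (translation (of_real k * u) y) = 0" using img y r by fastforce
  moreover have "side (of_real s * u) (translation (of_real k * u) y) * N y = A * (r\<^sup>2 + 1) - 2 * B * r"
    using formula[of y] r(1) unfolding y by simp
  ultimately have "A * (r\<^sup>2 + 1) = 2 * B * r" by simp
  then have B: "B = A * s'" using r by simp
  have key: "side (of_real s * u) (translation (of_real k * u) z) * N z = A * side (of_real s' * u) z"
  proof -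
    define R where "R = Re (cnj u * z)"
    have "side (of_real s * u) (translation (of_real k * u) z) * N z = A * ((norm z)\<^sup>2 + 1) - 2 * (A * s') * R"
      using formula[of z] z unfolding B R_def mem_cball dist_0_norm by blast
    also have "\<dots> = A * ((norm z)\<^sup>2 + 1 - 2 * s' * R)" by (simp add: algebra_simps)
    also have "\<dots> = A * side (of_real s' * u) z" unfolding side_u R_def ..
    finally show ?thesis .
  qed
  have k1: "2 * \<bar>k\<bar> \<le> 1 + k\<^sup>2" using zero_le_power2[of "1 - \<bar>k\<bar>"] by (simp add: power2_diff)
  have k2: "1 + k\<^sup>2 > 0" by (simp add: add_pos_nonneg)
  have A: "A < 0"
  proof (rule ccontr)
    assume A: "\<not> A < 0"
    show False
    proof (cases "s > 0")
      case True
      then have "1 * (1 + k\<^sup>2) < s * (1 + k\<^sup>2)" using s(1) k2 by (intro mult_strict_right_mono) auto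
      then have "B > 0" using k1 by (simp add: B_def)
      moreover have "s' < 0" using s(3) True by (simp add: mult_less_0_iff)
      ultimately show False using A by (simp add: B zero_less_mult_iff)
    next
      case False
      then have "s * (1 + k\<^sup>2) < - 1 * (1 + k\<^sup>2)" using s(1) k2 by (intro mult_strict_right_mono) auto
      then have "B < 0" using k1 by (simp add: B_def)
      moreover have "s' > 0" using s(3) False by (auto simp: mult_less_0_iff)
      ultimately show False using A by (simp add: B mult_less_0_iff)
    qed
  qed
  have w: "norm (of_real k * u) < 1" using u k by (simp add: norm_mult)
  have N: "N z > 0" using translation_denominator_nonzero[OF w] z by (simp add: N_def)
  have mz: "translation (of_real k * u) z \<in> cball 0 1" using conformal_ball(1)[OF conformal_translation[OF w] z] .
  define X where "X = side (of_real s * u) (translation (of_real k * u) z)"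
  define Y where "Y = side (of_real s' * u) z"
  have "X = A * Y / N z" using key N by (simp add: X_def Y_def field_simps)
  then have "X \<le> 0 \<longleftrightarrow> \<not> Y < 0" "X < 0 \<longleftrightarrow> \<not> Y \<le> 0"
    using A N by (auto simp: divide_le_0_iff divide_less_0_iff mult_le_0_iff mult_less_0_iff zero_le_mult_iff zero_less_mult_iff)
  then show "translation (of_real k * u) z \<in> half_disc (of_real s * u) \<longleftrightarrow> z \<notin> open_half_disc (of_real s' * u)"
    "translation (of_real k * u) z \<in> open_half_disc (of_real s * u) \<longleftrightarrow> z \<notin> half_disc (of_real s' * u)"
    using mz z by (auto simp: half_disc_def open_half_disc_def X_def Y_def)
qed

lemma exp_imaginary_real_cases:
  fixes t :: real
  assumes "Im (exp (\<i> * of_real t)) = 0"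
  shows "exp (\<i> * of_real t) = 1 \<or> exp (\<i> * of_real t) = -1"
proof -
  define E where "E = exp (\<i> * complex_of_real t)"
  have "norm E = 1" by (simp add: E_def)
  moreover have "E = of_real (Re E)" using assms by (simp add: E_def complex_eq_iff)
  ultimately have "\<bar>Re E\<bar> = 1" by (metis norm_of_real)
  then show ?thesis using \<open>E = of_real (Re E)\<close> unfolding E_def[symmetric]
    by (metis abs_eq_iff abs_one of_real_1 of_real_minus)
qed

text \<open>A disc automorphism preserving the diameter through \<open>u\<close> is a translation along it, possibly followed
  by the half-turn \<open>z \<mapsto> - z\<close>. The second case is a half-turn about a point of the disc, which has no
  fixed point on the circle and therefore is not hyperbolic.\<close>
lemma hyperbolic_axis_is_translation:
  assumes u: "norm u = 1" and hyp: "hyperbolic \<gamma>"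
    and axis: "\<gamma> ` {z \<in> ball 0 1. Im (cnj u * z) = 0} = {z \<in> ball 0 1. Im (cnj u * z) = 0}"
  obtains k :: real where "\<bar>k\<bar> < 1" "\<gamma> = restrict (translation (of_real k * u)) (cball 0 1)"
proof -
  let ?A = "{z \<in> ball 0 1. Im (cnj u * z) = 0}"
  obtain t w where w: "norm w < 1" and \<gamma>: "\<gamma> = restrict (Moebius_function t w) (cball 0 1)"
    using hyp unfolding hyperbolic_def disc_isometries_def by blast
  define e where "e = exp (\<i> * complex_of_real t)"
  have e: "e \<noteq> 0" "norm e = 1" by (auto simp: e_def)
  have \<gamma>_eq: "\<gamma> z = e * (z - w) / (1 - cnj w * z)" if "norm z \<le> 1" for z
    using that by (simp add: \<gamma> Moebius_function_def e_def)
  have uu: "cnj u * u = 1" using u by (metis complex_norm_square mult.commute of_real_1 one_power2)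
  have "0 \<in> ?A" by simp
  then have "0 \<in> \<gamma> ` ?A" using axis by simp
  then obtain x where x: "x \<in> ?A" "\<gamma> x = 0" by auto
  then have "e * (x - w) / (1 - cnj w * x) = 0" using \<gamma>_eq[of x] by simp
  then have "x = w" using e translation_denominator_nonzero[OF w, of x] x by simp
  define k where "k = Re (cnj u * w)"
  have "cnj u * w = of_real k" using x \<open>x = w\<close> by (simp add: k_def complex_eq_iff)
  then have w_eq: "w = of_real k * u" using uu by (metis mult.assoc mult.commute mult.right_neutral)
  have k: "\<bar>k\<bar> < 1" using w u by (simp add: w_eq norm_mult)
  \<comment> \<open>A point of the axis other than \<open>w\<close>, so that its image is a nonzero real multiple of \<open>e * u\<close>.\<close>
  define r where "r = (if k = 0 then 1 / 2 else 0 :: real)"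
  define q where "q = (r - k) / (1 - k * r)"
  have q: "q \<noteq> 0" "\<bar>r\<bar> < 1" by (auto simp: q_def r_def)
  have den: "1 - cnj w * (of_real r * u) = of_real (1 - k * r)"
  proof -
    have "cnj w * (of_real r * u) = of_real (k * r) * (cnj u * u)" by (simp add: w_eq)
    then show ?thesis by (simp only: uu) simp
  qed
  have "of_real r * u \<in> ?A"
  proof -
    have "cnj u * (of_real r * u) = of_real r * (cnj u * u)" by simp
    then have "Im (cnj u * (of_real r * u)) = 0" by (simp only: uu) simp
    then show ?thesis using q u by (simp add: norm_mult)
  qed
  then have "\<gamma> (of_real r * u) \<in> ?A" using axis by blast
  then have im0: "Im (cnj u * \<gamma> (of_real r * u)) = 0" by blast
  have \<gamma>r: "\<gamma> (of_real r * u) = of_real q * (e * u)"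
  proof -
    have "\<gamma> (of_real r * u) = e * (of_real r * u - w) / of_real (1 - k * r)"
      using \<gamma>_eq[of "of_real r * u"] q u unfolding den by (simp add: norm_mult)
    also have "of_real r * u - w = of_real (r - k) * u" by (simp add: w_eq algebra_simps)
    finally show ?thesis by (simp add: q_def)
  qed
  have "Im (cnj u * (of_real q * (e * u))) = q * Im e"
  proof -
    have "cnj u * (of_real q * (e * u)) = of_real q * (e * (cnj u * u))" by (simp add: ac_simps)
    then show ?thesis by (simp only: uu) simp
  qed
  with im0 have "q * Im e = 0" unfolding \<gamma>r by (metis)
  then have "Im e = 0" using q by simp
  then have "e = 1 \<or> e = -1" using exp_imaginary_real_cases unfolding e_def by blast
  moreover have "e \<noteq> -1"
  proof
    assume e1: "e = -1"
    have "\<gamma> p \<noteq> p" if p: "p \<in> sphere 0 1" for p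
    proof
      assume "\<gamma> p = p"
      define y where "y = cnj u * p"
      have "u * y = (cnj u * u) * p" by (simp add: y_def)
      then have p_eq: "p = u * y" by (simp only: uu mult_1_left)
      have ny: "norm y = 1" using p u by (simp add: y_def norm_mult)
      have "1 - cnj w * p \<noteq> 0" using translation_denominator_nonzero[OF w, of p] p by simp
      moreover have "cnj w * p = of_real k * y" by (simp add: w_eq y_def mult.assoc)
      moreover have "e * (p - w) / (1 - cnj w * p) = p" using \<gamma>_eq[of p] p \<open>\<gamma> p = p\<close> by simp
      ultimately have "- (p - w) = p * (1 - of_real k * y)" using e1 by (simp add: divide_eq_eq)
      then have "u * (of_real k - 2 * y + of_real k * y * y) = 0" by (simp add: p_eq w_eq algebra_simps)
      moreover have "u \<noteq> 0" using u by auto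
      ultimately have "of_real k - 2 * y + of_real k * y * y = 0" by simp
      then have "cnj y * (of_real k - 2 * y + of_real k * y * y) = 0" by simp
      moreover have yy: "cnj y * y = 1" using ny by (metis complex_norm_square mult.commute of_real_1 one_power2)
      moreover have "cnj y * (of_real k - 2 * y + of_real k * y * y)
          = of_real k * cnj y - 2 * (cnj y * y) + of_real k * (cnj y * y) * y" by (simp add: algebra_simps)
      ultimately have "of_real k * cnj y - 2 + of_real k * y = 0" by simp
      then have "Re (of_real k * cnj y - 2 + of_real k * y) = 0" by simp
      then have "k * Re y = 1" by simp
      then have "\<bar>k\<bar> * \<bar>Re y\<bar> = 1" by (metis abs_mult abs_one)
      moreover have "\<bar>Re y\<bar> \<le> 1" using abs_Re_le_cmod[of y] ny by simp
      then have "\<bar>k\<bar> * \<bar>Re y\<bar> \<le> \<bar>k\<bar> * 1" by (intro mult_left_mono) auto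
      ultimately show False using k by simp
    qed
    then have "{p \<in> sphere 0 1. \<gamma> p = p} = {}" by blast
    then show False using hyp unfolding hyperbolic_def by (metis card.empty zero_neq_numeral)
  qed
  ultimately have "e = 1" by blast
  then have "Moebius_function t w = translation w"
    by (simp add: fun_eq_iff Moebius_function_def e_def)
  then show thesis using that k \<gamma> w_eq by simp
qed

section \<open>Chords of the unit circle\<close>

text \<open>A line meets the unit circle at most twice.\<close>
lemma unit_chord_zero:
  fixes x y p q p' q' :: real
  assumes "x\<^sup>2 + y\<^sup>2 = 1" "p\<^sup>2 + q\<^sup>2 = 1" "p'\<^sup>2 + q'\<^sup>2 = 1" "p \<noteq> p'"
    and L: "(y - q) * (p - p') + (x - p) * (q' - q) = 0"
  shows "(x = p \<and> y = q) \<or> (x = p' \<and> y = q')"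
proof -
  define l where "l = (x - p) / (p' - p)"
  have x: "x = p + l * (p' - p)" using assms(4) by (simp add: l_def)
  have "(p - p') * ((y - q) - l * (q' - q)) = 0" using L unfolding x by (simp add: algebra_simps)
  then have y: "y = q + l * (q' - q)" using assms(4) by simp
  have "l * (l - 1) * ((p' - p)\<^sup>2 + (q' - q)\<^sup>2) = 0"
    using assms(1-3) unfolding x y by algebra
  moreover have "(p' - p)\<^sup>2 > 0" using assms(4) by simp
  then have "(p' - p)\<^sup>2 + (q' - q)\<^sup>2 > 0" by (rule add_pos_nonneg) simp
  ultimately have "l = 0 \<or> l = 1" by auto
  then show ?thesis by (auto simp: x y)
qed

lemma chord_sign:
  fixes x y p q p' q' :: real
  assumes "\<bar>x\<bar> < p" "\<bar>x\<bar> < - p'" "\<bar>q\<bar> < y" "\<bar>q'\<bar> < y"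
  shows "(y - q) * (p - p') + (x - p) * (q' - q) > 0"
proof -
  have "(y - q) * (p - p') + (x - p) * (q' - q) = (p - x) * (y - q') + (y - q) * (x - p')"
    by (simp add: algebra_simps)
  also have "\<dots> > 0" using assms by (intro add_pos_pos mult_pos_pos) auto
  finally show ?thesis .
qed

text \<open>The chord from \<open>m\<close> to \<open>m'\<close> has \<open>\<zeta>\<close> and \<open>\<zeta>'\<close> on different sides, so the affine function \<open>L\<close> that vanishes
  on it has a zero on the connected set \<open>U\<close>; on the circle its only zeros are \<open>m\<close> and \<open>m'\<close>. Both
  choices of coordinates are admitted because either generator may provide the chord.\<close>
lemma chord_separates:
  fixes \<alpha> \<beta> :: "complex \<Rightarrow> real"
  assumes coord: "(\<alpha> = Re \<and> \<beta> = Im) \<or> (\<alpha> = Im \<and> \<beta> = Re)"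
    and U: "connected U" "U \<subseteq> sphere 0 1" "\<zeta> \<in> U" "\<zeta>' \<in> U"
    and m: "m \<in> sphere 0 1" "m' \<in> sphere 0 1" "m \<notin> U" "m' \<notin> U"
    and sign: "\<alpha> m * \<alpha> m' < 0" "\<beta> \<zeta> * \<beta> \<zeta>' < 0"
    and far: "\<bar>\<alpha> \<zeta>\<bar> < \<bar>\<alpha> m\<bar>" "\<bar>\<alpha> \<zeta>'\<bar> < \<bar>\<alpha> m\<bar>" "\<bar>\<alpha> \<zeta>\<bar> < \<bar>\<alpha> m'\<bar>" "\<bar>\<alpha> \<zeta>'\<bar> < \<bar>\<alpha> m'\<bar>"
      "\<bar>\<beta> m\<bar> < \<bar>\<beta> \<zeta>\<bar>" "\<bar>\<beta> m\<bar> < \<bar>\<beta> \<zeta>'\<bar>" "\<bar>\<beta> m'\<bar> < \<bar>\<beta> \<zeta>\<bar>" "\<bar>\<beta> m'\<bar> < \<bar>\<beta> \<zeta>'\<bar>"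
  shows False
proof -
  have main: False
    if pos: "\<alpha> m > 0" "\<alpha> m' < 0" "\<beta> \<zeta> > 0" "\<beta> \<zeta>' < 0"
      and U: "\<zeta> \<in> U" "\<zeta>' \<in> U" and m: "m \<in> sphere 0 1" "m' \<in> sphere 0 1" "m \<notin> U" "m' \<notin> U"
      and far: "\<bar>\<alpha> \<zeta>\<bar> < \<bar>\<alpha> m\<bar>" "\<bar>\<alpha> \<zeta>'\<bar> < \<bar>\<alpha> m\<bar>" "\<bar>\<alpha> \<zeta>\<bar> < \<bar>\<alpha> m'\<bar>" "\<bar>\<alpha> \<zeta>'\<bar> < \<bar>\<alpha> m'\<bar>"
      "\<bar>\<beta> m\<bar> < \<bar>\<beta> \<zeta>\<bar>" "\<bar>\<beta> m\<bar> < \<bar>\<beta> \<zeta>'\<bar>" "\<bar>\<beta> m'\<bar> < \<bar>\<beta> \<zeta>\<bar>" "\<bar>\<beta> m'\<bar> < \<bar>\<beta> \<zeta>'\<bar>"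
    for m m' \<zeta> \<zeta>'
  proof -
    define L where "L z = (\<beta> z - \<beta> m) * (\<alpha> m - \<alpha> m') + (\<alpha> z - \<alpha> m) * (\<beta> m' - \<beta> m)" for z
    have "continuous_on U L"
      unfolding L_def[abs_def] using coord by (auto intro!: continuous_intros)
    then have conn: "connected (L ` U)" using \<open>connected U\<close> by (rule connected_continuous_image)
    have "L \<zeta> > 0" unfolding L_def using pos far by (intro chord_sign) auto
    moreover have "(- \<beta> \<zeta>' - - \<beta> m) * (\<alpha> m - \<alpha> m') + (\<alpha> \<zeta>' - \<alpha> m) * (- \<beta> m' - - \<beta> m) > 0"
      using pos far by (intro chord_sign) auto
    then have "L \<zeta>' < 0" unfolding L_def by (simp add: algebra_simps)
    ultimately have "0 \<in> L ` U"
      using connectedD_interval[OF conn, of "L \<zeta>'" "L \<zeta>" 0] U by auto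
    then obtain z where z: "z \<in> U" "L z = 0" by auto
    have unit: "(\<alpha> y)\<^sup>2 + (\<beta> y)\<^sup>2 = 1" if "y \<in> sphere 0 1" for y
      using that coord cmod_power2[of y] by (auto simp: add.commute)
    have zs: "z \<in> sphere 0 1" using z(1) \<open>U \<subseteq> sphere 0 1\<close> by blast
    have ne: "\<alpha> m \<noteq> \<alpha> m'" using pos by simp
    have "(\<alpha> z = \<alpha> m \<and> \<beta> z = \<beta> m) \<or> (\<alpha> z = \<alpha> m' \<and> \<beta> z = \<beta> m')"
      using unit_chord_zero[OF unit[OF zs] unit[OF m(1)] unit[OF m(2)] ne] z(2) unfolding L_def by blast
    then have "z = m \<or> z = m'" using coord by (auto simp: complex_eq_iff)
    then show False using z m by blast
  qed
  have "(\<alpha> m > 0 \<and> \<alpha> m' < 0) \<or> (\<alpha> m' > 0 \<and> \<alpha> m < 0)"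
    "(\<beta> \<zeta> > 0 \<and> \<beta> \<zeta>' < 0) \<or> (\<beta> \<zeta>' > 0 \<and> \<beta> \<zeta> < 0)"
    using sign by (auto simp: mult_less_0_iff)
  then show False
    using main[of m m' \<zeta> \<zeta>'] main[of m' m \<zeta> \<zeta>'] main[of m m' \<zeta>' \<zeta>] main[of m' m \<zeta>' \<zeta>] U(3,4) m far by blast
qed

section \<open>The group generated by two perpendicular translations\<close>

definition axis_dir :: "bool \<Rightarrow> complex" where
  "axis_dir b = (if b then \<i> else 1)"

definition coord :: "bool \<Rightarrow> complex \<Rightarrow> real" where
  "coord b = (if b then Im else Re)"

lemma axis_dir_simps: "norm (axis_dir b) = 1" "Re (cnj (axis_dir b) * z) = coord b z"
  by (auto simp: axis_dir_def coord_def)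

lemma coord_sum: "(coord b z)\<^sup>2 + (coord (\<not> b) z)\<^sup>2 = (norm z)\<^sup>2"
  by (auto simp: coord_def cmod_power2)

lemma side_coord: "side (of_real s * axis_dir b) z = (norm z)\<^sup>2 + 1 - 2 * s * coord b z"
  by (auto simp: side_def axis_dir_def coord_def)

text \<open>The index is the axis: \<open>False\<close> for the real and \<open>True\<close> for the imaginary one. The translation along
  it carries the geodesic with centre parameter \<open>s'\<close> to the one with parameter \<open>s\<close>.\<close>
locale translation_pair =
  fixes s s' :: "bool \<Rightarrow> real" and k :: "bool \<Rightarrow> real"
  assumes k: "\<bar>k b\<bar> < 1" and s: "\<bar>s b\<bar> > 1" "\<bar>s' b\<bar> > 1" "s b * s' b < 0"
    and img: "translation (of_real (k b) * axis_dir b) ` {z \<in> ball 0 1. side (of_real (s' b) * axis_dir b) z = 0}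
      = {z \<in> ball 0 1. side (of_real (s b) * axis_dir b) z = 0}"
    and perp: "\<And>c d. c \<in> {s False, s' False} \<Longrightarrow> d \<in> {s True, s' True} \<Longrightarrow> 1 / c\<^sup>2 + 1 / d\<^sup>2 > 1"
begin

definition centre :: "letter \<Rightarrow> real" where
  "centre x = (if snd x then s (fst x) else s' (fst x))"

definition map_of_letter :: "letter \<Rightarrow> complex \<Rightarrow> complex" where
  "map_of_letter x = translation (of_real (if snd x then k (fst x) else - k (fst x)) * axis_dir (fst x))"

definition region :: "letter \<Rightarrow> complex set" where
  "region x = half_disc (of_real (centre x) * axis_dir (fst x))"

definition open_region :: "letter \<Rightarrow> complex set" where
  "open_region x = open_half_disc (of_real (centre x) * axis_dir (fst x))"

lemma centre_gt_1: "\<bar>centre x\<bar> > 1"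
  using s by (simp add: centre_def)

lemma centre_linv: "centre x * centre (linv x) < 0"
  using s(3)[of "fst x"] by (simp add: centre_def linv_def mult.commute)

lemma centre_perp:
  assumes "fst x \<noteq> fst y"
  shows "1 / (centre x)\<^sup>2 + 1 / (centre y)\<^sup>2 > 1"
proof (cases "fst x")
  case True
  then show ?thesis using perp[of "centre y" "centre x"] assms by (auto simp: centre_def add.commute split: if_splits)
next
  case False
  then show ?thesis using perp[of "centre x" "centre y"] assms by (auto simp: centre_def split: if_splits)
qed

lemma norm_translation: "norm (of_real (if b then k c else - k c) * axis_dir c) < 1"
  using k by (simp add: norm_mult axis_dir_simps)

lemma region_coord:
  assumes "m \<in> region x \<inter> sphere 0 1"
  shows "centre x * coord (fst x) m \<ge> 1"
  using assms by (auto simp: region_def half_disc_def side_coord)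

lemma region_coord_square:
  assumes "m \<in> region x \<inter> sphere 0 1"
  shows "(coord (fst x) m)\<^sup>2 \<ge> 1 / (centre x)\<^sup>2"
proof -
  have "1\<^sup>2 \<le> (centre x * coord (fst x) m)\<^sup>2" using region_coord[OF assms] by (intro power_mono) auto
  moreover have "(centre x)\<^sup>2 > 0" using centre_gt_1[of x] by auto
  ultimately show ?thesis by (simp add: power_mult_distrib field_simps)
qed

text \<open>On the circle the squares of the coordinates add up to 1, whereas the inequality for perpendicular
  geodesics bounds the sum of the squares of the dominant coordinates of \<open>m\<close> and \<open>z\<close> from below.\<close>
lemma region_far:
  assumes m: "m \<in> region x \<inter> sphere 0 1" and z: "z \<in> region y \<inter> sphere 0 1" and xy: "fst x \<noteq> fst y"
  shows "\<bar>coord (fst x) z\<bar> < \<bar>coord (fst x) m\<bar>" "\<bar>coord (fst y) m\<bar> < \<bar>coord (fst y) z\<bar>"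
proof -
  have y: "fst y = (\<not> fst x)" using xy by auto
  have "(coord (fst x) z)\<^sup>2 + (coord (fst y) z)\<^sup>2 = 1" "(coord (fst x) m)\<^sup>2 + (coord (fst y) m)\<^sup>2 = 1"
    using coord_sum[of "fst x"] m z y by auto
  moreover note region_coord_square[OF m] region_coord_square[OF z] centre_perp[OF xy]
  ultimately have "(coord (fst x) z)\<^sup>2 < (coord (fst x) m)\<^sup>2" "(coord (fst y) m)\<^sup>2 < (coord (fst y) z)\<^sup>2" by linarith+
  then show "\<bar>coord (fst x) z\<bar> < \<bar>coord (fst x) m\<bar>" "\<bar>coord (fst y) m\<bar> < \<bar>coord (fst y) z\<bar>"
    by (metis abs_ge_zero power2_abs power2_less_imp_less)+
qed

lemma region_opposite:
  assumes "m \<in> region x \<inter> sphere 0 1" "m' \<in> region (linv x) \<inter> sphere 0 1"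
  shows "coord (fst x) m * coord (fst x) m' < 0"
proof -
  have "centre x * coord (fst x) m > 0" "centre (linv x) * coord (fst x) m' > 0"
    using region_coord[OF assms(1)] region_coord[OF assms(2)] by auto
  then show ?thesis using centre_linv[of x] by (auto simp: zero_less_mult_iff mult_less_0_iff)
qed

lemma map_of_letter_inverse: "z \<in> cball 0 1 \<Longrightarrow> map_of_letter (linv x) (map_of_letter x z) = z"
  using translation_inverse[OF norm_translation[of "snd x" "fst x"], of z]
  by (cases "snd x") (auto simp: map_of_letter_def linv_def)

lemma map_of_letter_cball: "z \<in> cball 0 1 \<Longrightarrow> map_of_letter x z \<in> cball 0 1"
  unfolding map_of_letter_def by (rule conformal_ball(1)[OF conformal_translation[OF norm_translation]])

lemma pairing_positive:
  assumes z: "z \<in> cball 0 1"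
  shows "map_of_letter (b, True) z \<in> region (b, True) \<longleftrightarrow> z \<notin> open_region (b, False)"
    "map_of_letter (b, True) z \<in> open_region (b, True) \<longleftrightarrow> z \<notin> region (b, False)"
  using translation_pairs_half_discs[OF axis_dir_simps(1) k s img z, of b]
  by (simp_all add: map_of_letter_def region_def open_region_def centre_def)

lemma regions_disjoint:
  assumes "x \<noteq> y"
  shows "region x \<inter> region y = {}"
proof (cases "fst x = fst y")
  case True
  then have "y = linv x" using assms fst_eq_cases by (metis linv_linv)
  then show ?thesis using opposite_half_discs_disjoint[OF centre_linv[of x]] by (simp add: region_def)
next
  case False
  have disj: "region x \<inter> region y = {}" if "\<not> fst x" "fst y" for x y
    using perpendicular_half_discs_disjoint[of "centre x" "centre y"] centre_perp[of x y] that
      centre_gt_1[of x] centre_gt_1[of y] by (auto simp: region_def axis_dir_def mult.commute)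
  show ?thesis using disj[of x y] disj[of y x] False by blast
qed

lemma continuous_side: "continuous_on S (side c)"
  unfolding side_def[abs_def] by (intro continuous_intros)

sublocale schottky map_of_letter region open_region
proof
  fix x y :: letter
  show "conformal (map_of_letter x)" unfolding map_of_letter_def by (rule conformal_translation[OF norm_translation])
  show "continuous_on (cball 0 1) (map_of_letter x)"
    unfolding map_of_letter_def by (rule continuous_translation[OF norm_translation])
  show "map_of_letter (linv x) (map_of_letter x z) = z" if "z \<in> cball 0 1" for z
    using map_of_letter_inverse[OF that] .
  show "map_of_letter x z \<in> region x \<longleftrightarrow> z \<notin> open_region (linv x)" if z: "z \<in> cball 0 1" for z
  proof (cases "snd x")
    case True
    then have "x = (fst x, True)" "linv x = (fst x, False)" by (auto simp: linv_def prod_eq_iff)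
    then show ?thesis using pairing_positive(1)[OF z] by metis
  next
    case False
    then have x: "x = (fst x, False)" "linv x = (fst x, True)" by (auto simp: linv_def prod_eq_iff)
    show ?thesis
      using pairing_positive(2)[OF map_of_letter_cball[OF z], of "fst x" x] map_of_letter_inverse[OF z, of x] x by metis
  qed
  show "x \<noteq> y \<Longrightarrow> region x \<inter> region y = {}" by (rule regions_disjoint)
  show "open_region x \<subseteq> region x" by (auto simp: region_def open_region_def half_disc_def open_half_disc_def)
  show "region x \<subseteq> cball 0 1" by (auto simp: region_def half_disc_def)
  show "closed (region x)"
  proof -
    have "region x = cball 0 1 \<inter> {z. side (of_real (centre x) * axis_dir (fst x)) z \<le> 0}"
      by (auto simp: region_def half_disc_def)
    moreover have "closed {z. side (of_real (centre x) * axis_dir (fst x)) z \<le> 0}"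
      by (intro closed_Collect_le continuous_side continuous_on_const)
    ultimately show ?thesis by (simp add: closed_Int)
  qed
  show "openin (top_of_set (cball 0 1)) (open_region x)"
  proof -
    have "open_region x = cball 0 1 \<inter> {z. side (of_real (centre x) * axis_dir (fst x)) z < 0}"
      by (auto simp: open_region_def open_half_disc_def)
    moreover have "open {z. side (of_real (centre x) * axis_dir (fst x)) z < 0}"
      by (intro open_Collect_less continuous_side continuous_on_const)
    ultimately show ?thesis by (simp add: openin_open_Int)
  qed
  show "0 \<notin> region x" by (simp add: region_def half_disc_def side_def)
  show "\<exists>\<zeta>\<in>sphere 0 1. \<zeta> \<in> region x - open_region x"
  proof -
    \<comment> \<open>The end of the geodesic has this number as its coordinate along the axis.\<close>
    define r where "r = 1 / centre x"
    have c: "centre x * r = 1" using centre_gt_1[of x] by (auto simp: r_def)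
    have "\<bar>r\<bar> \<le> 1" using centre_gt_1[of x] by (simp add: r_def)
    then have r: "r\<^sup>2 \<le> 1" by (simp add: abs_square_le_1)
    define \<zeta> where "\<zeta> = (if fst x then Complex (sqrt (1 - r\<^sup>2)) r else Complex r (sqrt (1 - r\<^sup>2)))"
    have "(norm \<zeta>)\<^sup>2 = 1" unfolding cmod_power2 using r by (simp add: \<zeta>_def)
    then have n: "norm \<zeta> = 1" by (simp add: abs_square_eq_1)
    have "coord (fst x) \<zeta> = r" by (simp add: coord_def \<zeta>_def)
    then have "side (of_real (centre x) * axis_dir (fst x)) \<zeta> = 0" unfolding side_coord using n c by simp
    then show ?thesis
      using n by (intro bexI[of _ \<zeta>]) (auto simp: region_def open_region_def half_disc_def open_half_disc_def)
  qed
  fix U m m'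
  assume U: "connected U" "U \<subseteq> sphere 0 1" and m: "m \<in> region x \<inter> sphere 0 1" "m \<notin> U"
    and m': "m' \<in> region (linv x) \<inter> sphere 0 1" "m' \<notin> U" and xy: "fst y \<noteq> fst x"
  show "U \<inter> region y = {} \<or> U \<inter> region (linv y) = {}"
  proof (rule ccontr)
    assume "\<not> ?thesis"
    then obtain \<zeta> \<zeta>' where \<zeta>: "\<zeta> \<in> U" "\<zeta> \<in> region y" "\<zeta>' \<in> U" "\<zeta>' \<in> region (linv y)" by blast
    have z: "\<zeta> \<in> region y \<inter> sphere 0 1" "\<zeta>' \<in> region (linv y) \<inter> sphere 0 1" using \<zeta> U(2) by auto
    have ne: "fst x \<noteq> fst y" "fst x \<noteq> fst (linv y)" "fst (linv x) \<noteq> fst y" "fst (linv x) \<noteq> fst (linv y)"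
      using xy by auto
    note far = region_far[OF m(1) z(1) ne(1)] region_far[OF m(1) z(2) ne(2)]
      region_far[OF m'(1) z(1) ne(3)] region_far[OF m'(1) z(2) ne(4)]
    note far = far[unfolded fst_linv]
    show False
    proof (rule chord_separates[of "coord (fst x)" "coord (fst y)", OF _ U \<zeta>(1,3) _ _ m(2) m'(2)])
      show "(coord (fst x) = Re \<and> coord (fst y) = Im) \<or> (coord (fst x) = Im \<and> coord (fst y) = Re)"
        using xy by (auto simp: coord_def)
      show "coord (fst x) m * coord (fst x) m' < 0" using region_opposite[OF m(1) m'(1)] .
      show "coord (fst y) \<zeta> * coord (fst y) \<zeta>' < 0" using region_opposite[OF z] .
    qed (insert m(1) m'(1), (rule far | blast)+)
  qed
qed

end

lemma generated_group_acts_by_words: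
  assumes F: "\<And>x z. z \<in> cball 0 1 \<Longrightarrow> F (linv x) (F x z) = (z :: complex)" "\<And>x z. z \<in> cball 0 1 \<Longrightarrow> F x z \<in> cball 0 1"
    and g: "g = restrict (F (False, True)) (cball 0 1)" and h: "h = restrict (F (True, True)) (cball 0 1)"
  shows "\<gamma> \<in> generated_group {g, h} \<Longrightarrow> \<exists>w. \<forall>z\<in>cball 0 1. \<gamma> z = foldr F w z"
    and "\<exists>\<gamma>\<in>generated_group {g, h}. \<forall>z\<in>cball 0 1. \<gamma> z = foldr F w z"
proof -
  let ?S = "cball 0 1 :: complex set"
  define R where "R x = restrict (F x) ?S" for x
  let ?G = "BijGroup ?S"
  interpret G: group ?G by (rule group_BijGroup)
  have bij: "R x \<in> Bij ?S" for x
  proof -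
    have "bij_betw (R x) ?S ?S"
      by (rule bij_betw_byWitness[where f' = "F (linv x)"])
        (use F(1)[of _ x] F(1)[of _ "linv x"] F(2)[of _ x] F(2)[of _ "linv x"] in \<open>auto simp: R_def\<close>)
    then show ?thesis by (simp add: Bij_def R_def)
  qed
  have mult: "(\<gamma> \<otimes>\<^bsub>?G\<^esub> \<delta>) z = \<gamma> (\<delta> z)" if "\<gamma> \<in> Bij ?S" "\<delta> \<in> Bij ?S" "z \<in> ?S" for \<gamma> \<delta> z
    using that by (simp add: BijGroup_def compose_def)
  have carrier: "carrier ?G = Bij ?S" by (simp add: BijGroup_def)
  have inv: "inv\<^bsub>?G\<^esub> (R x) = R (linv x)" for x
  proof (rule G.inv_equality)
    show "R (linv x) \<otimes>\<^bsub>?G\<^esub> R x = \<one>\<^bsub>?G\<^esub>"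
    proof
      fix z
      show "(R (linv x) \<otimes>\<^bsub>?G\<^esub> R x) z = \<one>\<^bsub>?G\<^esub> z"
      proof (cases "z \<in> ?S")
        case True
        have "(R (linv x) \<otimes>\<^bsub>?G\<^esub> R x) z = R (linv x) (R x z)"
          by (rule mult[OF bij bij True])
        also have "\<dots> = F (linv x) (F x z)"
          using True F(2)[OF True, of x] by (simp add: R_def del: mem_cball)
        finally show ?thesis using F(1)[OF True] True by (simp add: BijGroup_def)
      qed (simp add: BijGroup_def bij compose_def)
    qed
  qed (use bij carrier in auto)
  have gens: "{g, h} = {R (False, True), R (True, True)}" by (simp add: g h R_def)
  have letters: "R x \<in> generate ?G {g, h}" for x
  proof -
    have gh: "R (b, True) \<in> {g, h}" for b unfolding gens by (cases b) auto
    obtain b c where x: "x = (b, c)" by force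
    show ?thesis
    proof (cases c)
      case True
      then show ?thesis using generate.incl[OF gh] x by simp
    next
      case False
      then have "R x = inv\<^bsub>?G\<^esub> (R (b, True))" by (simp add: inv x linv_def)
      then show ?thesis using generate.inv[OF gh] by simp
    qed
  qed
  have sub: "generate ?G {g, h} \<subseteq> Bij ?S"
    using G.generate_incl[of "{g, h}"] bij by (simp add: gens carrier)
  show "\<exists>w. \<forall>z\<in>?S. \<gamma> z = foldr F w z" if "\<gamma> \<in> generated_group {g, h}"
    using that unfolding generated_group_def
  proof (induction rule: generate.induct)
    case one
    show ?case by (rule exI[of _ "[]"]) (simp add: BijGroup_def)
  next
    case (incl \<gamma>)
    then obtain x where "\<gamma> = R x" unfolding gens by blast
    then show ?case by (intro exI[of _ "[x]"]) (simp add: R_def)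
  next
    case (inv \<gamma>)
    then obtain x where "\<gamma> = R x" unfolding gens by blast
    then show ?case using \<open>\<And>x. inv\<^bsub>?G\<^esub> (R x) = R (linv x)\<close> by (intro exI[of _ "[linv x]"]) (simp add: R_def)
  next
    case (eng \<gamma> \<delta>)
    then obtain v w where vw: "\<forall>z\<in>?S. \<gamma> z = foldr F v z" "\<forall>z\<in>?S. \<delta> z = foldr F w z" by blast
    have b: "\<gamma> \<in> Bij ?S" "\<delta> \<in> Bij ?S" using eng sub by auto
    have "(\<gamma> \<otimes>\<^bsub>?G\<^esub> \<delta>) z = foldr F (v @ w) z" if z: "z \<in> ?S" for z
    proof -
      have "\<delta> z \<in> ?S" using Bij_imp_funcset[OF b(2)] z by blast
      then show ?thesis using vw z mult[OF b z] by simp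
    qed
    then show ?case by blast
  qed
  show "\<exists>\<gamma>\<in>generated_group {g, h}. \<forall>z\<in>?S. \<gamma> z = foldr F w z"
    unfolding generated_group_def
  proof (induction w)
    case Nil
    show ?case by (rule bexI[OF _ generate.one]) (simp add: BijGroup_def)
  next
    case (Cons x w)
    then obtain \<delta> where \<delta>: "\<delta> \<in> generate ?G {g, h}" "\<forall>z\<in>?S. \<delta> z = foldr F w z" by blast
    have d: "\<delta> \<in> Bij ?S" using \<delta> sub by blast
    have "(R x \<otimes>\<^bsub>?G\<^esub> \<delta>) z = foldr F (x # w) z" if z: "z \<in> ?S" for z
    proof -
      have "\<delta> z \<in> ?S" using Bij_imp_funcset[OF d] z by blast
      then show ?thesis using mult[OF bij d z] \<delta> z by (simp add: R_def)
    qed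
    then show ?case using generate.eng[OF letters \<delta>(1)] by blast
  qed
qed

lemma uncountable_nat_bool: "uncountable (UNIV :: (nat \<Rightarrow> bool) set)"
proof
  assume "countable (UNIV :: (nat \<Rightarrow> bool) set)"
  then obtain e :: "nat \<Rightarrow> nat \<Rightarrow> bool" where e: "range e = UNIV"
    by (metis uncountable_def UNIV_not_empty)
  then obtain n where "(\<lambda>i. \<not> e i i) = e n" by (metis rangeE UNIV_I)
  then show False by metis
qed

context translation_pair
begin

text \<open>Coding is injective on reduced sequences, so the points coded by the sequences constructed above
  are as numerous as the binary sequences.\<close>
lemma uncountably_many_uncontrolled_concentration_points:
  assumes "\<And>\<gamma>. \<gamma> \<in> \<Gamma> \<Longrightarrow> \<exists>w. \<forall>z\<in>cball 0 1. \<gamma> z = act w z"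
      "\<And>w. \<exists>\<gamma>\<in>\<Gamma>. \<forall>z\<in>cball 0 1. \<gamma> z = act w z"
  shows "uncountable {p. limit_point \<Gamma> p \<and> concentration_point \<Gamma> p \<and> \<not> controlled_concentration_point \<Gamma> p}"
proof -
  have "\<forall>\<sigma>. \<exists>z. codes (coded_seq \<sigma>) z" using exists_coded[OF reduced_seq_coded_seq] by metis
  then obtain P where P: "\<And>\<sigma>. codes (coded_seq \<sigma>) (P \<sigma>)" by metis
  have "inj P"
  proof (rule injI)
    fix \<sigma> \<tau> assume "P \<sigma> = P \<tau>"
    then have "coded_seq \<sigma> = coded_seq \<tau>"
      using codes_inj[OF P[of \<sigma>] _ reduced_seq_coded_seq reduced_seq_coded_seq] P[of \<tau>] by metis
    then show "\<sigma> = \<tau>" using inj_coded_seq by (simp add: inj_eq)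
  qed
  then have "uncountable (range P)" using uncountable_nat_bool countable_image_inj_eq by blast
  moreover have "range P \<subseteq> {p. limit_point \<Gamma> p \<and> concentration_point \<Gamma> p \<and> \<not> controlled_concentration_point \<Gamma> p}"
    using coded_point_classification[OF assms reduced_seq_coded_seq P coded_seq_frequently coded_seq_nonrecurrent]
    by blast
  ultimately show ?thesis using countable_subset by blast
qed

end

theorem theorem4p2:
  fixes a a' b b' :: "complex set"
    and g h :: "complex \<Rightarrow> complex"
    and \<Gamma>\<^sub>0 :: "(complex \<Rightarrow> complex) set"
  assumes "schottky_geodesics a a' b b'"
    and "hyperbolic g" "g ` real_axis = real_axis" "g ` a' = a"
    and "hyperbolic h" "h ` imaginary_axis = imaginary_axis" "h ` b' = b"
    and "\<Gamma>\<^sub>0 = generated_group {g, h}"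
  shows "uncountable {p. limit_point \<Gamma>\<^sub>0 p \<and> concentration_point \<Gamma>\<^sub>0 p
                          \<and> \<not> controlled_concentration_point \<Gamma>\<^sub>0 p}"
proof -
  obtain s s' where s: "s * s' < 0" "circle_geodesic (of_real s) a" "circle_geodesic (of_real s') a'"
    using assms(1) unfolding schottky_geodesics_def by blast
  obtain t t' where t: "t * t' < 0" "circle_geodesic (\<i> * of_real t) b" "circle_geodesic (\<i> * of_real t') b'"
    using assms(1) unfolding schottky_geodesics_def by blast
  have real: "real_axis = {z \<in> ball 0 1. Im (cnj (axis_dir False) * z) = 0}"
    and imag: "imaginary_axis = {z \<in> ball 0 1. Im (cnj (axis_dir True) * z) = 0}"
    by (auto simp: real_axis_def imaginary_axis_def axis_dir_def)
  obtain k where k: "\<bar>k\<bar> < 1" "g = restrict (translation (of_real k * axis_dir False)) (cball 0 1)"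
    using hyperbolic_axis_is_translation[OF axis_dir_simps(1) assms(2) assms(3)[unfolded real]] .
  obtain l where l: "\<bar>l\<bar> < 1" "h = restrict (translation (of_real l * axis_dir True)) (cball 0 1)"
    using hyperbolic_axis_is_translation[OF axis_dir_simps(1) assms(5) assms(6)[unfolded imag]] .
  define S where "S b = (if b then t else s)" for b
  define S' where "S' b = (if b then t' else s')" for b
  define K where "K b = (if b then l else k)" for b
  have dirs: "of_real c * axis_dir False = of_real c" "of_real c * axis_dir True = \<i> * of_real c" for c
    by (auto simp: axis_dir_def)
  note side_eq = circle_geodesic_side(2)[OF s(2)] circle_geodesic_side(2)[OF s(3)]
    circle_geodesic_side(2)[OF t(2)] circle_geodesic_side(2)[OF t(3)]
  note gt_1 = circle_geodesic_side(1)[OF s(2)] circle_geodesic_side(1)[OF s(3)]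
    circle_geodesic_side(1)[OF t(2)] circle_geodesic_side(1)[OF t(3)]
  have sub: "a' \<subseteq> cball 0 1" "b' \<subseteq> cball 0 1" using side_eq by auto
  have disj: "disjnt (closure a) (closure b)" "disjnt (closure a) (closure b')"
    "disjnt (closure a') (closure b)" "disjnt (closure a') (closure b')"
    using assms(1) unfolding schottky_geodesics_def by simp_all
  note perp = perpendicular_geodesics_disjoint[OF s(2) t(2) disj(1)]
    perpendicular_geodesics_disjoint[OF s(2) t(3) disj(2)]
    perpendicular_geodesics_disjoint[OF s(3) t(2) disj(3)]
    perpendicular_geodesics_disjoint[OF s(3) t(3) disj(4)]
  interpret T: translation_pair S S' K
  proof
    fix i
    show "\<bar>K i\<bar> < 1" using k l by (simp add: K_def)
    show "\<bar>S i\<bar> > 1" "\<bar>S' i\<bar> > 1" using gt_1 by (auto simp: S_def S'_def norm_mult)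
    show "S i * S' i < 0" using s t by (simp add: S_def S'_def)
    have "translation (of_real k * axis_dir False) ` a' = a" "translation (of_real l * axis_dir True) ` b' = b"
      using assms(4,7) sub k(2) l(2) by (auto simp: image_restrict_eq subset_iff image_iff)
    then show "translation (of_real (K i) * axis_dir i) ` {z \<in> ball 0 1. side (of_real (S' i) * axis_dir i) z = 0}
      = {z \<in> ball 0 1. side (of_real (S i) * axis_dir i) z = 0}"
      using side_eq by (cases i) (simp_all add: K_def S_def S'_def dirs)
  next
    fix c d assume "c \<in> {S False, S' False}" "d \<in> {S True, S' True}"
    then consider "c = s" "d = t" | "c = s" "d = t'" | "c = s'" "d = t" | "c = s'" "d = t'"
      by (auto simp: S_def S'_def)
    then show "1 / c\<^sup>2 + 1 / d\<^sup>2 > 1"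
      using perp by cases simp_all
  qed
  have gh: "g = restrict (T.map_of_letter (False, True)) (cball 0 1)"
    "h = restrict (T.map_of_letter (True, True)) (cball 0 1)"
    using k l by (simp_all add: T.map_of_letter_def K_def)
  show ?thesis
    unfolding assms(8)
    by (rule T.uncountably_many_uncontrolled_concentration_points
        [OF generated_group_acts_by_words[OF T.map_of_letter_inverse T.map_of_letter_cball gh]])
qed

end
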